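(* Let $\theta\ge1$, let $A$ be a $\theta$-SDD matrix of size $n$, and let $0<\varepsilon<1$. There is a randomized linear time algorithm that, given $A$, $\|A\|$ and $\varepsilon$, outputs a matrix $\widetilde A\in\mathbb{R}^{n\times n}$ with at most $\mathcal{O}(n\theta\log n/\varepsilon^2)$ non-zero entries such that, with probability at least $1-1/n$, $\|A-\widetilde A\|\le\varepsilon\|A\|$.
   Context: $\|\cdot\|$ is the operator norm and $\|A\|_\infty=\max_i\sum_j|A_{ij}|$. A real matrix $A$ is called $\theta$-symmetric diagonally dominant ($\theta$-SDD) if $A$ is symmetric and $\|A\|_\infty\le\sqrt{\theta}\,\|A\|$. *)

theory Defs
  imports
    "HOL-Probability.Probability"
    "Jordan_Normal_Form.Matrix"
begin

section \<open>Norms and diagonal dominance\<close>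

definition eucl_norm :: "real vec \<Rightarrow> real" where
  "eucl_norm v = sqrt (scalar_prod v v)"

definition op_norm :: "real mat \<Rightarrow> real" where
  "op_norm A = Sup {eucl_norm (mult_mat_vec A v) | v.
                      v \<in> carrier_vec (dim_col A) \<and> eucl_norm v \<le> 1}"

text \<open>Meaningful for matrices with at least one row.\<close>

definition inf_norm :: "real mat \<Rightarrow> real" where
  "inf_norm A = Max ((\<lambda>i. \<Sum>j<dim_col A. \<bar>A $$ (i, j)\<bar>) ` {..<dim_row A})"

definition SDD :: "real \<Rightarrow> real mat \<Rightarrow> bool" where
  "SDD \<theta> A \<longleftrightarrow> transpose_mat A = A \<and> inf_norm A \<le> sqrt \<theta> * op_norm A"

definition nnz :: "real mat \<Rightarrow> nat" where
  "nnz A = card {(i, j). i < dim_row A \<and> j < dim_col A \<and> A $$ (i, j) \<noteq> 0}"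


section \<open>Matrices as lists of entries\<close>

text \<open>
  An algorithm reads and writes a matrix as a list of triples (row, column, entry). Every position
  occurs at most once, positions that do not occur carry the entry 0, and the order is arbitrary.
  Zero entries may be listed, so both the list of the non-zero entries and the list of
  all \<open>n\<^sup>2\<close> entries represent a matrix of size \<open>n\<close>.
\<close>

type_synonym entries = "(nat \<times> nat \<times> real) list"

definition wf_entries :: "nat \<Rightarrow> entries \<Rightarrow> bool" where
  "wf_entries n es \<longleftrightarrow>
     distinct (map (\<lambda>(i, j, a). (i, j)) es) \<and> (\<forall>(i, j, a) \<in> set es. i < n \<and> j < n)"

definition mat_of_entries :: "nat \<Rightarrow> entries \<Rightarrow> real mat" where
  "mat_of_entries n es =
     mat n n (\<lambda>(i, j). \<Sum>(i', j', a) \<leftarrow> es. if i' = i \<and> j' = j then a else 0)"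


section \<open>A randomized real RAM\<close>

text \<open>
  The machine model is the usual unit-cost real RAM with random choices, programmed in a structured
  language. The memory consists of named arrays of natural numbers and of named arrays of reals; a
  scalar is kept in cell 0 of an array. Natural numbers only support addition and truncated
  subtraction, reals support the field operations and comparison. Arrays are indexed by
  natural numbers, and a natural number may be converted into a real but not conversely (no
  rounding). Constants in programs are natural numbers, so no real number with special digits can
  be built into a program.
\<close>

datatype nexp =
    NConst nat
  | NRead string nexp
  | NAdd nexp nexp
  | NSub nexp nexp

datatype rexp =
    ROfNat nexp
  | RRead string nexp
  | RAdd rexp rexp
  | RSub rexp rexp
  | RMul rexp rexp
  | RDiv rexp rexp

datatype bexp =
    NLess nexp nexp
  | RLess rexp rexp
  | BNot bexp
  | BAnd bexp bexp

text \<open>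
  \<open>Flip x e p\<close> stores in cell \<open>e\<close> of the array \<open>x\<close> the outcome (1 or 0) of a fresh coin toss that
  yields 1 with probability \<open>p\<close>; \<^const>\<open>bernoulli_pmf\<close> clamps \<open>p\<close> to the unit interval.
\<close>

datatype com =
    Skip
  | NAssign string nexp nexp
  | RAssign string nexp rexp
  | Flip string nexp rexp
  | Seq com com
  | Cond bexp com com
  | While bexp com

record state =
  nmem :: "string \<Rightarrow> nat \<Rightarrow> nat"
  rmem :: "string \<Rightarrow> nat \<Rightarrow> real"

primrec neval :: "nexp \<Rightarrow> state \<Rightarrow> nat" where
  "neval (NConst k) s = k"
| "neval (NRead x e) s = nmem s x (neval e s)"
| "neval (NAdd e f) s = neval e s + neval f s"
| "neval (NSub e f) s = neval e s - neval f s"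

primrec reval :: "rexp \<Rightarrow> state \<Rightarrow> real" where
  "reval (ROfNat e) s = real (neval e s)"
| "reval (RRead x e) s = rmem s x (neval e s)"
| "reval (RAdd e f) s = reval e s + reval f s"
| "reval (RSub e f) s = reval e s - reval f s"
| "reval (RMul e f) s = reval e s * reval f s"
| "reval (RDiv e f) s = reval e s / reval f s"

primrec beval :: "bexp \<Rightarrow> state \<Rightarrow> bool" where
  "beval (NLess e f) s = (neval e s < neval f s)"
| "beval (RLess e f) s = (reval e s < reval f s)"
| "beval (BNot b) s = (\<not> beval b s)"
| "beval (BAnd b c) s = (beval b s \<and> beval c s)"

definition nupd :: "string \<Rightarrow> nat \<Rightarrow> nat \<Rightarrow> state \<Rightarrow> state" where
  "nupd x i k s = s\<lparr>nmem := (nmem s)(x := (nmem s x)(i := k))\<rparr>"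

definition rupd :: "string \<Rightarrow> nat \<Rightarrow> real \<Rightarrow> state \<Rightarrow> state" where
  "rupd x i r s = s\<lparr>rmem := (rmem s)(x := (rmem s x)(i := r))\<rparr>"

definition add_time :: "nat \<Rightarrow> state \<times> nat \<Rightarrow> state \<times> nat" where
  "add_time k = (\<lambda>(s, t). (s, k + t))"

text \<open>
  \<open>run c s D\<close>: started in \<open>s\<close>, the program \<open>c\<close> terminates for every outcome of its coin tosses, and
  \<open>D\<close> is the joint distribution of the final state and the running time. Every assignment, coin
  toss and evaluation of a branch or loop condition takes one time unit. The number of operations
  within an expression is bounded by the size of the program, which is independent of the input,
  so this changes the running time by at most a constant factor.
\<close>

inductive run :: "com \<Rightarrow> state \<Rightarrow> (state \<times> nat) pmf \<Rightarrow> bool" where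
  run_Skip: "run Skip s (return_pmf (s, 1))"
| run_NAssign: "run (NAssign x e f) s (return_pmf (nupd x (neval e s) (neval f s) s, 1))"
| run_RAssign: "run (RAssign x e f) s (return_pmf (rupd x (neval e s) (reval f s) s, 1))"
| run_Flip: "run (Flip x e p) s
     (map_pmf (\<lambda>b. (nupd x (neval e s) (of_bool b) s, 1)) (bernoulli_pmf (reval p s)))"
| run_Seq: "\<lbrakk>run c s D; \<And>s' t. (s', t) \<in> set_pmf D \<Longrightarrow> run d s' (E s')\<rbrakk> \<Longrightarrow>
     run (Seq c d) s (bind_pmf D (\<lambda>(s', t). map_pmf (add_time t) (E s')))"
| run_CondTrue: "\<lbrakk>beval b s; run c s D\<rbrakk> \<Longrightarrow> run (Cond b c d) s (map_pmf (add_time 1) D)"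
| run_CondFalse: "\<lbrakk>\<not> beval b s; run d s D\<rbrakk> \<Longrightarrow> run (Cond b c d) s (map_pmf (add_time 1) D)"
| run_WhileFalse: "\<not> beval b s \<Longrightarrow> run (While b c) s (return_pmf (s, 1))"
| run_WhileTrue: "\<lbrakk>beval b s; run (Seq c (While b c)) s D\<rbrakk> \<Longrightarrow>
     run (While b c) s (map_pmf (add_time 1) D)"

lemma run_deterministic: "run c s D \<Longrightarrow> run c s D' \<Longrightarrow> D' = D"
proof (induction arbitrary: D' rule: run.induct)
  case (run_Seq c s D d E)
  from run_Seq.prems obtain D1 E1 where D': "D' = bind_pmf D1 (\<lambda>(s', t). map_pmf (add_time t) (E1 s'))"
    and 1: "run c s D1" and 2: "\<And>s' t. (s', t) \<in> set_pmf D1 \<Longrightarrow> run d s' (E1 s')"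
    by (cases rule: run.cases) auto
  have "D1 = D" using run_Seq.IH(1)[OF 1] .
  with 2 run_Seq.IH(2) have "\<And>s' t. (s', t) \<in> set_pmf D \<Longrightarrow> E1 s' = E s'" by blast
  then show ?case unfolding D' \<open>D1 = D\<close> by (intro bind_pmf_cong) auto
qed (erule run.cases; blast)+


section \<open>Input and output\<close>

text \<open>
  The cells that do not hold the input are initially 0. The input occupies
  \<open>input_size es\<close> memory cells: three for each listed entry, and one each for the size of the
  matrix, the number of listed entries, the norm and the accuracy.
\<close>

definition input_state :: "nat \<Rightarrow> entries \<Rightarrow> real \<Rightarrow> real \<Rightarrow> state" where
  "input_state n es nrm \<epsilon> = \<lparr>
     nmem = (\<lambda>_ _. 0)
       (''dim'' := (\<lambda>_. 0)(0 := n),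
        ''len'' := (\<lambda>_. 0)(0 := length es),
        ''row'' := (\<lambda>k. if k < length es then fst (es ! k) else 0),
        ''col'' := (\<lambda>k. if k < length es then fst (snd (es ! k)) else 0)),
     rmem = (\<lambda>_ _. 0)
       (''val'' := (\<lambda>k. if k < length es then snd (snd (es ! k)) else 0),
        ''norm'' := (\<lambda>_. 0)(0 := nrm),
        ''eps'' := (\<lambda>_. 0)(0 := \<epsilon>))\<rparr>"

definition input_size :: "entries \<Rightarrow> nat" where
  "input_size es = 3 * length es + 4"

definition output_entries :: "state \<Rightarrow> entries" where
  "output_entries s =
     map (\<lambda>k. (nmem s ''outrow'' k, nmem s ''outcol'' k, rmem s ''outval'' k))
       [0..<nmem s ''outlen'' 0]"

definition output_mat :: "nat \<Rightarrow> state \<Rightarrow> real mat" where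
  "output_mat n s = mat_of_entries n (output_entries s)"

end

theory Submission
  imports Defs
begin

text \<open>Write \<open>N\<close> for the norm of \<open>A\<close> and \<open>M\<close> for its largest absolute row sum, and put
  \<open>J = M + N\<close>. Every listed entry \<open>a\<close> is kept independently with probability \<open>p = min 1 (K \<bar>a\<bar>)\<close> and then
  replaced by \<open>a / p\<close>, where \<open>K\<close> is of order \<open>J log n / (\<epsilon> N)\<^sup>2\<close>. The expected number of kept
  entries is at most \<open>K n M\<close>, which is \<open>O(n \<theta> log n / \<epsilon>\<^sup>2)\<close> as \<open>J \<le> 2 \<surd>\<theta> N\<close>; by a Chernoff bound the
  output can be discarded when it is too long. The logarithm is replaced by the harmonic number of
  the input length, which the machine can compute in linear time; inputs with at most \<open>n\<close> entries are kept
  unchanged.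

  Matrix concentration inequalities are replaced by the moment method. The error matrix \<open>E\<close> satisfies
  \<open>\<parallel>E\<parallel>\<^sup>t \<le> tr ((E\<^sup>T E)\<^sup>q)\<close> for \<open>t = 2 q\<close> and \<open>q\<close> a power of two, and the trace is a sum over walks of
  length \<open>t\<close>. Errors are centred, so only walks that use each of their entries at least twice contribute
  to its expectation. Choosing the next entry of a walk costs at most a factor \<open>J / z\<close> if the entry
  is new and \<open>z / K\<close> if it is one of the at most \<open>t\<close> entries used before. With \<open>t\<close> of order \<open>log n\<close> and
  the best \<open>z\<close>, Markov's inequality gives the claim.\<close>

section \<open>Distribution of the final state\<close>

text \<open>Separates the joint law into the law of the final state and a worst-case time. Laws then
  compose by \<open>bind_pmf\<close>, and times simply add.\<close>

definition runs :: "com \<Rightarrow> state \<Rightarrow> state pmf \<Rightarrow> nat \<Rightarrow> bool" where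
  "runs c s Q T \<longleftrightarrow> (\<exists>D. run c s D \<and> map_pmf fst D = Q \<and> (\<forall>x\<in>set_pmf D. snd x \<le> T))"

lemma runs_mono: "runs c s Q T \<Longrightarrow> T \<le> T' \<Longrightarrow> runs c s Q T'"
  unfolding runs_def by fastforce

lemma runs_Skip: "runs Skip s (return_pmf s) 1"
  unfolding runs_def by (intro exI[of _ "return_pmf (s, 1)"]) (auto intro: run.intros simp del: One_nat_def)

lemma runs_NAssign: "runs (NAssign x e f) s (return_pmf (nupd x (neval e s) (neval f s) s)) 1"
  unfolding runs_def
  by (intro exI[of _ "return_pmf (nupd x (neval e s) (neval f s) s, 1)"]) (auto intro: run.intros simp del: One_nat_def)

lemma runs_RAssign: "runs (RAssign x e f) s (return_pmf (rupd x (neval e s) (reval f s) s)) 1"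
  unfolding runs_def
  by (intro exI[of _ "return_pmf (rupd x (neval e s) (reval f s) s, 1)"]) (auto intro: run.intros simp del: One_nat_def)

lemma runs_Flip:
  "runs (Flip x e p) s (map_pmf (\<lambda>b. nupd x (neval e s) (of_bool b) s) (bernoulli_pmf (reval p s))) 1"
  unfolding runs_def
  by (rule exI, intro conjI, rule run_Flip) (auto simp: map_pmf_comp)

lemma runs_Seq:
  assumes "runs c s Q T" and "\<And>s'. s' \<in> set_pmf Q \<Longrightarrow> runs d s' (Q' s') T'"
  shows "runs (Seq c d) s (bind_pmf Q Q') (T + T')"
proof -
  from assms(1) obtain D where D: "run c s D" "map_pmf fst D = Q" "\<forall>x\<in>set_pmf D. snd x \<le> T"
    unfolding runs_def by blast
  \<comment> \<open>\<open>run_Seq\<close> wants one function from states to laws, so a law is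
    chosen for every intermediate state that can occur.\<close>
  have "\<forall>s'. \<exists>D'. s' \<in> set_pmf Q \<longrightarrow>
      run d s' D' \<and> map_pmf fst D' = Q' s' \<and> (\<forall>x\<in>set_pmf D'. snd x \<le> T')"
    using assms(2) unfolding runs_def by blast
  then obtain E where E: "\<And>s'. s' \<in> set_pmf Q \<Longrightarrow>
      run d s' (E s') \<and> map_pmf fst (E s') = Q' s' \<and> (\<forall>x\<in>set_pmf (E s'). snd x \<le> T')"
    by metis
  have Q: "set_pmf Q = fst ` set_pmf D" by (simp flip: D(2))
  let ?F = "bind_pmf D (\<lambda>(s', t). map_pmf (add_time t) (E s'))"
  have "run (Seq c d) s ?F"
    by (rule run_Seq[OF D(1)]) (use E Q in force)
  moreover have "map_pmf fst ?F = bind_pmf Q Q'"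
  proof -
    have "map_pmf fst ?F = bind_pmf D (\<lambda>x. map_pmf fst (map_pmf (add_time (snd x)) (E (fst x))))"
      by (simp add: map_bind_pmf case_prod_unfold)
    also have "\<dots> = bind_pmf D (\<lambda>x. Q' (fst x))"
    proof (intro bind_pmf_cong refl)
      fix x assume "x \<in> set_pmf D"
      then have "map_pmf fst (E (fst x)) = Q' (fst x)" using E Q by auto
      moreover have "fst \<circ> add_time (snd x) = fst" by (auto simp: add_time_def fun_eq_iff)
      ultimately show "map_pmf fst (map_pmf (add_time (snd x)) (E (fst x))) = Q' (fst x)"
        by (simp add: pmf.map_comp)
    qed
    also have "\<dots> = bind_pmf Q Q'" by (simp add: D(2)[symmetric] bind_map_pmf)
    finally show ?thesis .
  qed
  moreover have "\<forall>x\<in>set_pmf ?F. snd x \<le> T + T'"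
  proof
    fix x assume "x \<in> set_pmf ?F"
    then obtain s' t y where y: "(s', t) \<in> set_pmf D" "y \<in> set_pmf (E s')" "x = add_time t y"
      by auto
    have "s' \<in> set_pmf Q" using y(1) Q by force
    then have "snd y \<le> T'" using E y(2) by blast
    moreover have "t \<le> T" using D(3) y(1) by force
    ultimately show "snd x \<le> T + T'" by (simp add: y(3) add_time_def case_prod_unfold)
  qed
  ultimately show ?thesis unfolding runs_def by blast
qed

text \<open>Common shape of both branches of a conditional and of loop unfolding: the law of the
  state is inherited, and one unit pays for the test.\<close>

lemma runs_add_time:
  assumes "\<And>D. run c s D \<Longrightarrow> run d s' (map_pmf (add_time 1) D)" and "runs c s Q T"
  shows "runs d s' Q (Suc T)"
proof -
  from assms(2) obtain D where D: "run c s D" "map_pmf fst D = Q" "\<forall>x\<in>set_pmf D. snd x \<le> T"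
    unfolding runs_def by blast
  have "fst \<circ> add_time 1 = fst" by (auto simp: add_time_def fun_eq_iff)
  then show ?thesis unfolding runs_def using D assms(1)[OF D(1)]
    by (intro exI[of _ "map_pmf (add_time 1) D"]) (auto simp: pmf.map_comp add_time_def)
qed

lemma runs_CondTrue: "beval b s \<Longrightarrow> runs c s Q T \<Longrightarrow> runs (Cond b c d) s Q (Suc T)"
  by (rule runs_add_time[of c s]) (auto intro: run.intros simp del: One_nat_def)

lemma runs_CondFalse: "\<not> beval b s \<Longrightarrow> runs d s Q T \<Longrightarrow> runs (Cond b c d) s Q (Suc T)"
  by (rule runs_add_time[of d s]) (auto intro: run.intros simp del: One_nat_def)

lemma runs_WhileFalse: "\<not> beval b s \<Longrightarrow> runs (While b c) s (return_pmf s) 1"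
  unfolding runs_def by (intro exI[of _ "return_pmf (s, 1)"]) (auto intro: run.intros simp del: One_nat_def)

lemma runs_WhileTrue:
  "beval b s \<Longrightarrow> runs (Seq c (While b c)) s Q T \<Longrightarrow> runs (While b c) s Q (Suc T)"
  by (rule runs_add_time[of "Seq c (While b c)" s]) (rule run_WhileTrue)

lemma runs_Seq_return:
  "runs c s (return_pmf s') T \<Longrightarrow> runs d s' Q T' \<Longrightarrow> runs (Seq c d) s Q (T + T')"
  using runs_Seq[of c s "return_pmf s'" T d "\<lambda>_. Q" T'] by (simp add: bind_return_pmf)

lemma runs_unique: "runs c s Q T \<Longrightarrow> runs c s Q' T' \<Longrightarrow> Q = Q'"
  unfolding runs_def using run_deterministic by blast

text \<open>The intermediate state is indexed by random data \<open>x\<close>, and \<open>g\<close>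
  may identify several values of it. These start \<open>d\<close> in the same state, so
  \<open>runs_unique\<close> forces equal laws, and conditioning on \<open>x\<close> is
  sound.\<close>

lemma runs_Seq_map:
  assumes "runs c s (map_pmf g P) T" and d: "\<And>x. x \<in> set_pmf P \<Longrightarrow> runs d (g x) (Q x) T'"
  shows "runs (Seq c d) s (bind_pmf P Q) (T + T')"
proof -
  let ?r = "\<lambda>s'. SOME x. x \<in> set_pmf P \<and> g x = s'"
  have r: "?r (g x) \<in> set_pmf P \<and> g (?r (g x)) = g x" if "x \<in> set_pmf P" for x
    by (rule someI[of "\<lambda>y. y \<in> set_pmf P \<and> g y = g x"]) (use that in simp)
  have "runs (Seq c d) s (bind_pmf (map_pmf g P) (\<lambda>s'. Q (?r s'))) (T + T')"
  proof (rule runs_Seq[OF assms(1)])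
    fix s' assume "s' \<in> set_pmf (map_pmf g P)"
    then obtain x where x: "x \<in> set_pmf P" "s' = g x" by auto
    then show "runs d s' (Q (?r s')) T'" using d[of "?r s'"] r[of x] by simp
  qed
  also have "bind_pmf (map_pmf g P) (\<lambda>s'. Q (?r s')) = bind_pmf P (\<lambda>x. Q (?r (g x)))"
    by (simp add: bind_map_pmf)
  also have "\<dots> = bind_pmf P Q"
  proof (intro bind_pmf_cong refl)
    fix x assume x: "x \<in> set_pmf P"
    show "Q (?r (g x)) = Q x"
      using d[of "?r (g x)"] d[OF x] r[OF x] by (metis runs_unique)
  qed
  finally show ?thesis .
qed

section \<open>Programs without loops and coin tosses\<close>

primrec straight :: "com \<Rightarrow> bool" where
  "straight Skip = True"
| "straight (NAssign x e f) = True"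
| "straight (RAssign x e f) = True"
| "straight (Flip x e p) = False"
| "straight (Seq c d) = (straight c \<and> straight d)"
| "straight (Cond b c d) = (straight c \<and> straight d)"
| "straight (While b c) = False"

text \<open>On the \<open>straight\<close> fragment the outcome is a function of the state, which
  leaves loop bodies to simplification. The equations for \<open>Flip\<close> and
  \<open>While\<close> are placeholders outside that fragment.\<close>

primrec exec :: "com \<Rightarrow> state \<Rightarrow> state" where
  "exec Skip s = s"
| "exec (NAssign x e f) s = nupd x (neval e s) (neval f s) s"
| "exec (RAssign x e f) s = rupd x (neval e s) (reval f s) s"
| "exec (Flip x e p) s = s"
| "exec (Seq c d) s = exec d (exec c s)"
| "exec (Cond b c d) s = (if beval b s then exec c s else exec d s)"
| "exec (While b c) s = s"

primrec cost :: "com \<Rightarrow> nat" where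
  "cost Skip = 1"
| "cost (NAssign x e f) = 1"
| "cost (RAssign x e f) = 1"
| "cost (Flip x e p) = 1"
| "cost (Seq c d) = cost c + cost d"
| "cost (Cond b c d) = Suc (max (cost c) (cost d))"
| "cost (While b c) = 1"

lemma runs_straight: "straight c \<Longrightarrow> runs c s (return_pmf (exec c s)) (cost c)"
proof (induction c arbitrary: s)
  case (Seq c d)
  then show ?case by (auto intro: runs_Seq_return)
next
  case (Cond b c d)
  show ?case
  proof (cases "beval b s")
    case True
    with Cond show ?thesis
      by (auto intro!: runs_CondTrue intro: runs_mono[OF _ max.cobounded1])
  next
    case False
    with Cond show ?thesis
      by (auto intro!: runs_CondFalse intro: runs_mono[OF _ max.cobounded2])
  qed
qed (auto simp del: One_nat_def intro: runs_Skip runs_NAssign runs_RAssign)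

section \<open>Counted loops, deterministic and with one coin per iteration\<close>

lemma runs_While_straight:
  assumes c: "straight c"
    and step: "\<And>k s. k < m \<Longrightarrow> I k s \<Longrightarrow> beval b s \<and> I (Suc k) (exec c s)"
    and final: "\<And>s. I m s \<Longrightarrow> \<not> beval b s"
    and init: "I 0 s"
  shows "\<exists>s'. runs (While b c) s (return_pmf s') (m * Suc (cost c) + 1) \<and> I m s'"
proof -
  \<comment> \<open>\<open>k\<close> iterations are done and \<open>m - k\<close> remain. Each costs
    its body and its test; the last unit pays for the failing test.\<close>
  have "\<exists>s'. runs (While b c) s (return_pmf s') ((m - k) * Suc (cost c) + 1) \<and> I m s'"
    if "k \<le> m" "I k s" for k s
    using that
  proof (induction k arbitrary: s rule: inc_induct)
    case base
    then show ?case using runs_WhileFalse[OF final] by force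
  next
    case (step k)
    note st = assms(2)[OF step.hyps(2) step.prems]
    obtain s' where s': "runs (While b c) (exec c s) (return_pmf s') ((m - Suc k) * Suc (cost c) + 1)"
      "I m s'" using step.IH st by blast
    have "runs (While b c) s (return_pmf s') (Suc (cost c + ((m - Suc k) * Suc (cost c) + 1)))"
      using st by (intro runs_WhileTrue runs_Seq_return[OF runs_straight[OF c] s'(1)]) auto
    moreover have "Suc (cost c + ((m - Suc k) * Suc (cost c) + 1)) = (m - k) * Suc (cost c) + 1"
      using step.hyps(2) by (simp add: Suc_diff_Suc[symmetric])
    ultimately show ?case using s'(2) by metis
  qed
  from this[of 0 s] init show ?thesis by simp
qed

text \<open>Iteration \<open>k\<close> tosses only coin \<open>k\<close>, so unfolding the loop
  draws the coordinates of the product law one by one. The assumption \<open>local\<close>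
  reconciles an arbitrary initial \<open>\<sigma>\<close> with the default \<open>False\<close> of
  \<open>Pi_pmf\<close> outside \<open>{..<m}\<close>.\<close>

lemma runs_While_coins:
  fixes st :: "nat \<Rightarrow> (nat \<Rightarrow> bool) \<Rightarrow> state"
  assumes step: "\<And>k \<sigma>. k < m \<Longrightarrow> beval b (st k \<sigma>) \<and>
      runs c (st k \<sigma>) (map_pmf (\<lambda>x. st (Suc k) (\<sigma>(k := x))) (p k)) T"
    and final: "\<And>\<sigma>. \<not> beval b (st m \<sigma>)"
    and local: "\<And>\<sigma> \<sigma>'. (\<And>i. i < m \<Longrightarrow> \<sigma> i = \<sigma>' i) \<Longrightarrow> st m \<sigma> = st m \<sigma>'"
  shows "runs (While b c) (st 0 \<sigma>) (map_pmf (st m) (Pi_pmf {..<m} False p)) (m * Suc T + 1)"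
proof -
  \<comment> \<open>Coins below \<open>k\<close> are fixed by \<open>\<sigma>\<close>; the later
    ones are still random.\<close>
  have "runs (While b c) (st k \<sigma>)
      (map_pmf (\<lambda>\<sigma>'. st m (\<lambda>i. if i < k then \<sigma> i else \<sigma>' i)) (Pi_pmf {k..<m} False p))
      ((m - k) * Suc T + 1)"
    if "k \<le> m" for k \<sigma>
    using that
  proof (induction k arbitrary: \<sigma> rule: inc_induct)
    case base
    have "st m (\<lambda>i. if i < m then \<sigma> i else False) = st m \<sigma>" by (rule local) auto
    then show ?case using runs_WhileFalse[OF final[of \<sigma>]] by simp
  next
    case (step k)
    let ?Q = "\<lambda>x. map_pmf (\<lambda>\<sigma>'. st m (\<lambda>i. if i < Suc k then (\<sigma>(k := x)) i else \<sigma>' i))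
        (Pi_pmf {Suc k..<m} False p)"
    note st = assms(1)[OF step.hyps(2), of \<sigma>]
    have "runs (Seq c (While b c)) (st k \<sigma>) (bind_pmf (p k) ?Q) (T + ((m - Suc k) * Suc T + 1))"
      using st step.IH by (intro runs_Seq_map) blast+
    then have "runs (While b c) (st k \<sigma>) (bind_pmf (p k) ?Q) (Suc (T + ((m - Suc k) * Suc T + 1)))"
      using st by (intro runs_WhileTrue) auto
    moreover have "Suc (T + ((m - Suc k) * Suc T + 1)) = (m - k) * Suc T + 1"
      using step.hyps(2) by (simp add: Suc_diff_Suc[symmetric])
    \<comment> \<open>By independence, coin \<open>k\<close> may be drawn first and the later coins
      afterwards.\<close>
    moreover have "map_pmf (\<lambda>\<sigma>'. st m (\<lambda>i. if i < k then \<sigma> i else \<sigma>' i)) (Pi_pmf {k..<m} False p)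
        = bind_pmf (p k) ?Q"
    proof -
      have "{k..<m} = insert k {Suc k..<m}" using step.hyps(2) by auto
      then have "map_pmf (\<lambda>\<sigma>'. st m (\<lambda>i. if i < k then \<sigma> i else \<sigma>' i)) (Pi_pmf {k..<m} False p)
        = bind_pmf (p k) (\<lambda>x. map_pmf (\<lambda>\<sigma>'. st m (\<lambda>i. if i < k then \<sigma> i else (\<sigma>'(k := x)) i))
            (Pi_pmf {Suc k..<m} False p))"
        by (simp add: Pi_pmf_insert' map_bind_pmf map_pmf_def[symmetric] pmf.map_comp o_def)
      also have "(\<lambda>x \<sigma>'. st m (\<lambda>i. if i < k then \<sigma> i else (\<sigma>'(k := x)) i))
          = (\<lambda>x \<sigma>'. st m (\<lambda>i. if i < Suc k then (\<sigma>(k := x)) i else \<sigma>' i))"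
        by (intro ext local) auto
      finally show ?thesis by metis
    qed
    ultimately show ?case by simp
  qed
  from this[of 0 \<sigma>] show ?thesis by (simp add: atLeast0LessThan)
qed

section \<open>Expectations of products of independent variables\<close>

lemma expectation_prod_Pi_pmf_finite:
  fixes f :: "'a \<Rightarrow> 'b \<Rightarrow> real"
  assumes "finite A" and "\<And>x. x \<in> A \<Longrightarrow> finite (set_pmf (p x))"
  shows "measure_pmf.expectation (Pi_pmf A d p) (\<lambda>y. \<Prod>x\<in>A. f x (y x)) =
    (\<Prod>x\<in>A. measure_pmf.expectation (p x) (f x))"
  using assms
proof (induction A rule: finite_induct)
  case empty
  then show ?case by simp
next
  case (insert x A)
  have fin: "finite (set_pmf (Pi_pmf A d p))"
    using insert by (intro finite_subset[OF set_Pi_pmf_subset'] finite_PiE_dflt) auto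
  have ex: "measure_pmf.expectation (p x) (f x) = (\<Sum>v\<in>set_pmf (p x). pmf (p x) v * f x v)"
    using insert.prems[of x] by (subst integral_measure_pmf[of "set_pmf (p x)"]) auto
  have "measure_pmf.expectation (Pi_pmf (insert x A) d p) (\<lambda>y. \<Prod>z\<in>insert x A. f z (y z))
      = measure_pmf.expectation (p x \<bind> (\<lambda>v. map_pmf (\<lambda>g. g(x := v)) (Pi_pmf A d p)))
          (\<lambda>y. \<Prod>z\<in>insert x A. f z (y z))"
    using insert by (simp add: Pi_pmf_insert' map_pmf_def)
  \<comment> \<open>Conditioning on the new coordinate; finite supports take care of integrability,
    so factors of either sign are allowed.\<close>
  also have "\<dots> = (\<Sum>v\<in>set_pmf (p x). pmf (p x) v *\<^sub>R measure_pmf.expectation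
      (map_pmf (\<lambda>g. g(x := v)) (Pi_pmf A d p)) (\<lambda>y. \<Prod>z\<in>insert x A. f z (y z)))"
    using insert fin by (intro pmf_expectation_bind) auto
  also have "\<dots> = (\<Sum>v\<in>set_pmf (p x). pmf (p x) v *\<^sub>R (f x v *
      measure_pmf.expectation (Pi_pmf A d p) (\<lambda>y. \<Prod>z\<in>A. f z (y z))))"
  proof (intro sum.cong refl arg_cong[where f = "\<lambda>t. _ *\<^sub>R t"])
    fix v
    have "(\<Prod>z\<in>insert x A. f z ((g(x := v)) z)) = f x v * (\<Prod>z\<in>A. f z (g z))" for g
      using insert(1,2) by (subst prod.insert) (auto intro!: prod.cong)
    then show "measure_pmf.expectation (map_pmf (\<lambda>g. g(x := v)) (Pi_pmf A d p))
        (\<lambda>y. \<Prod>z\<in>insert x A. f z (y z)) =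
      f x v * measure_pmf.expectation (Pi_pmf A d p) (\<lambda>y. \<Prod>z\<in>A. f z (y z))"
      by simp
  qed
  also have "\<dots> = measure_pmf.expectation (p x) (f x) *
      measure_pmf.expectation (Pi_pmf A d p) (\<lambda>y. \<Prod>z\<in>A. f z (y z))"
    by (simp add: ex sum_distrib_right mult.assoc)
  finally show ?case using insert by simp
qed

text \<open>Regroups the factors along a walk by edge, so that each edge contributes a single moment
  once independence is applied.\<close>

lemma prod_list_eq_prod_power:
  fixes f :: "'a \<Rightarrow> 'b :: comm_monoid_mult"
  assumes "finite A" and "set w \<subseteq> A"
  shows "(\<Prod>l\<leftarrow>w. f l) = (\<Prod>l\<in>A. f l ^ count_list w l)"
  using assms(2)
proof (induction w)
  case (Cons k w)
  have "(\<Prod>l\<in>A. f l ^ count_list (k # w) l) = (\<Prod>l\<in>A. (if l = k then f l else 1) * f l ^ count_list w l)"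
    by (intro prod.cong) auto
  also have "\<dots> = f k * (\<Prod>l\<in>A. f l ^ count_list w l)"
    using assms(1) Cons.prems by (simp add: prod.distrib)
  finally show ?case using Cons by simp
qed simp

section \<open>Trace moments by counting walks\<close>

text \<open>A walk is a list of edges, the last step first. Edges are traversed alternately from column to
  row and from row to column, as in a product \<open>E\<^sup>T E E\<^sup>T E \<dots>\<close>.\<close>

locale edges =
  fixes n m :: nat and r c :: "nat \<Rightarrow> nat"
  assumes r_less: "l < m \<Longrightarrow> r l < n" and c_less: "l < m \<Longrightarrow> c l < n"
begin

definition source :: "nat \<Rightarrow> nat \<Rightarrow> nat" where "source t l = (if even t then c l else r l)"
definition target :: "nat \<Rightarrow> nat \<Rightarrow> nat" where "target t l = (if even t then r l else c l)"

fun endpoint :: "nat \<Rightarrow> nat list \<Rightarrow> nat" where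
  "endpoint i [] = i"
| "endpoint i (l # w) = target (length w) l"

text \<open>Closing up is not built in, because walks grow edge by edge; the trace imposes
  \<open>endpoint i w = i\<close> afterwards.\<close>

primrec walks :: "nat \<Rightarrow> nat \<Rightarrow> nat list set" where
  "walks i 0 = {[]}"
| "walks i (Suc t) = (\<lambda>(w, l). l # w) `
     (SIGMA w : walks i t. {l. l < m \<and> source t l = endpoint i w})"

lemma length_walks: "w \<in> walks i t \<Longrightarrow> length w = t"
  by (induction t arbitrary: w) auto

lemma finite_walks: "finite (walks i t)"
  by (induction t) auto

lemma set_walks: "w \<in> walks i t \<Longrightarrow> set w \<subseteq> {..<m}"
  by (induction t arbitrary: w) fastforce+

lemma endpoint_less: "i < n \<Longrightarrow> w \<in> walks i t \<Longrightarrow> endpoint i w < n"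
  by (cases t) (auto simp: target_def r_less c_less)

lemma sum_walks_Suc:
  "(\<Sum>w\<in>walks i (Suc t). f w) =
    (\<Sum>w\<in>walks i t. \<Sum>l | l < m \<and> source t l = endpoint i w. f (l # w))"
proof -
  have "inj_on (\<lambda>(w, l). l # w) X" for X :: "(nat list \<times> nat) set"
    by (auto simp: inj_on_def)
  then show ?thesis
    by (simp add: sum.reindex sum.Sigma finite_walks case_prod_unfold)
qed

subsection \<open>Powers of the Gram matrix\<close>

definition edge_mat :: "(nat \<Rightarrow> real) \<Rightarrow> real mat" where
  "edge_mat x = mat n n (\<lambda>(i, j). \<Sum>l | l < m \<and> r l = i \<and> c l = j. x l)"

text \<open>One factor is appended at a time, to match the growth of walks by one edge;
  \<open>alternating_even\<close> recovers the powers of the Gram matrix.\<close>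

primrec alternating :: "(nat \<Rightarrow> real) \<Rightarrow> nat \<Rightarrow> real mat" where
  "alternating x 0 = 1\<^sub>m n"
| "alternating x (Suc t) = alternating x t *
     (if even t then transpose_mat (edge_mat x) else edge_mat x)"

lemma edge_mat_carrier: "edge_mat x \<in> carrier_mat n n"
  by (simp add: edge_mat_def)

lemma alternating_carrier: "alternating x t \<in> carrier_mat n n"
  by (induction t) (auto simp: edge_mat_def)

lemma alternating_even:
  "alternating x (2 * k) = (transpose_mat (edge_mat x) * edge_mat x) ^\<^sub>m k"
proof (induction k)
  case 0
  then show ?case by (simp add: edge_mat_def)
next
  case (Suc k)
  have "alternating x (2 * Suc k) = alternating x (2 * k) * transpose_mat (edge_mat x) * edge_mat x"
    by simp
  also have "\<dots> = alternating x (2 * k) * (transpose_mat (edge_mat x) * edge_mat x)"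
    by (rule assoc_mult_mat[of _ n n _ n _ n]) (auto simp: alternating_carrier edge_mat_def)
  finally show ?case using Suc by simp
qed

text \<open>A walk of length \<open>Suc t\<close> splits at the vertex reached after
  \<open>t\<close> steps, which is the inner index of the last matrix product.\<close>

lemma alternating_entry:
  assumes "i < n" "j < n"
  shows "alternating x t $$ (i, j) = (\<Sum>w | w \<in> walks i t \<and> endpoint i w = j. \<Prod>l\<leftarrow>w. x l)"
  using assms(2)
proof (induction t arbitrary: j)
  case 0
  have "{w. w = [] \<and> endpoint i w = j} = (if i = j then {[]} else {})" by auto
  then show ?case using assms 0 by auto
next
  case (Suc t)
  let ?X = "if even t then transpose_mat (edge_mat x) else edge_mat x"
  have X: "?X $$ (k, j) = (\<Sum>l | l < m \<and> source t l = k. if target t l = j then x l else 0)"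
    if "k < n" for k
  proof -
    have "?X $$ (k, j) = (\<Sum>l | l < m \<and> source t l = k \<and> target t l = j. x l)"
      using that Suc.prems by (auto simp: edge_mat_def source_def target_def intro!: sum.cong)
    also have "\<dots> = (\<Sum>l | l < m \<and> source t l = k. if target t l = j then x l else 0)"
      by (subst sum.inter_filter[symmetric]) (auto intro!: sum.cong)
    finally show ?thesis .
  qed
  have "alternating x (Suc t) $$ (i, j) = (\<Sum>k<n. alternating x t $$ (i, k) * ?X $$ (k, j))"
    using assms(1) Suc.prems alternating_carrier[of x t]
    by (auto simp: scalar_prod_def edge_mat_def lessThan_atLeast0 intro!: sum.cong)
  also have "\<dots> = (\<Sum>k<n. \<Sum>w | w \<in> walks i t \<and> endpoint i w = k. (\<Prod>l\<leftarrow>w. x l) * ?X $$ (k, j))"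
    using Suc.IH by (simp add: sum_distrib_right)
  also have "\<dots> = (\<Sum>k<n. \<Sum>w | w \<in> walks i t \<and> endpoint i w = k.
      (\<Prod>l\<leftarrow>w. x l) * ?X $$ (endpoint i w, j))"
    by (intro sum.cong refl) auto
  \<comment> \<open>Each walk determines \<open>k\<close> as its endpoint, so the sum over
    \<open>k\<close> is absorbed.\<close>
  also have "\<dots> = (\<Sum>w\<in>walks i t. (\<Prod>l\<leftarrow>w. x l) * ?X $$ (endpoint i w, j))"
    using endpoint_less[OF assms(1)]
    by (intro sum.group finite_walks) auto
  also have "\<dots> = (\<Sum>w\<in>walks i t. \<Sum>l | l < m \<and> source t l = endpoint i w.
      if target t l = j then x l * (\<Prod>l\<leftarrow>w. x l) else 0)"
    using endpoint_less[OF assms(1)]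
    by (intro sum.cong refl) (auto simp: X sum_distrib_left intro!: sum.cong)
  also have "\<dots> = (\<Sum>w\<in>walks i (Suc t). if endpoint i w = j then (\<Prod>l\<leftarrow>w. x l) else 0)"
    unfolding sum_walks_Suc using length_walks by (intro sum.cong refl) auto
  also have "\<dots> = (\<Sum>w | w \<in> walks i (Suc t) \<and> endpoint i w = j. \<Prod>l\<leftarrow>w. x l)"
    by (subst sum.inter_filter[symmetric, OF finite_walks]) simp
  finally show ?case .
qed

subsection \<open>Expected weight of a walk\<close>

text \<open>Charged in the order of travel, so that walks can be summed one step at a time;
  \<open>weight_eq\<close> regroups by edges for the comparison with moments.\<close>

fun weight :: "real \<Rightarrow> (nat \<Rightarrow> real) \<Rightarrow> nat list \<Rightarrow> real" where
  "weight \<rho> b [] = 1"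
| "weight \<rho> b (l # w) = (if l \<in> set w then \<rho> else b l) * weight \<rho> b w"

lemma weight_eq:
  "weight \<rho> b w = (\<Prod>l\<in>set w. \<rho> ^ (count_list w l - 1) * b l)"
proof (induction w)
  case (Cons k w)
  \<comment> \<open>Positive counts keep the truncated subtraction \<open>count_list w l - 1\<close>
    exact.\<close>
  have pos: "l \<in> set w \<Longrightarrow> count_list w l > 0" for l
    by (simp add: count_list_0_iff flip: neq0_conv)
  show ?case
  proof (cases "k \<in> set w")
    case True
    have "(\<Prod>l\<in>set (k # w). \<rho> ^ (count_list (k # w) l - 1) * b l)
        = \<rho> ^ (count_list (k # w) k - 1) * b k *
          (\<Prod>l\<in>set w - {k}. \<rho> ^ (count_list w l - 1) * b l)"
      using True by (simp add: insert_absorb prod.remove[of "set w" k])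
    also have "\<dots> = \<rho> * (\<Prod>l\<in>set w. \<rho> ^ (count_list w l - 1) * b l)"
      using True pos[OF True] by (simp add: prod.remove[of "set w" k] power_eq_if)
    finally show ?thesis using True Cons by simp
  next
    case False
    have "(\<Prod>l\<in>set w. \<rho> ^ (count_list (k # w) l - 1) * b l)
        = (\<Prod>l\<in>set w. \<rho> ^ (count_list w l - 1) * b l)"
      using False by (intro prod.cong) auto
    then show ?thesis using False Cons by simp
  qed
qed simp

text \<open>Whatever the walk so far, its next step contributes at most \<open>\<beta>\<close> from
  all edges at the endpoint, plus \<open>\<rho>\<close> for each of the at most \<open>T\<close>
  edges used before. A fixed \<open>T\<close> gives the same factor at every step.\<close>

lemma sum_weight_le:
  assumes \<rho>: "\<rho> \<ge> 0" and b: "\<And>l. l < m \<Longrightarrow> b l \<ge> 0"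
    and row: "\<And>i. i < n \<Longrightarrow> (\<Sum>l | l < m \<and> r l = i. b l) \<le> \<beta>"
    and col: "\<And>j. j < n \<Longrightarrow> (\<Sum>l | l < m \<and> c l = j. b l) \<le> \<beta>"
    and i: "i < n" and t: "t \<le> T"
  shows "(\<Sum>w\<in>walks i t. weight \<rho> b w) \<le> (\<beta> + real T * \<rho>) ^ t"
  using t
proof (induction t)
  case (Suc t)
  have weight: "weight \<rho> b w \<ge> 0" if "set w \<subseteq> {..<m}" for w
    using that \<rho> b by (induction w) auto
  have \<beta>: "\<beta> \<ge> 0"
    using row[OF i] b by (intro order_trans[OF sum_nonneg row[OF i]]) auto
  have step: "(\<Sum>l | l < m \<and> source t l = endpoint i w. if l \<in> set w then \<rho> else b l) \<le> \<beta> + real T * \<rho>"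
    if w: "w \<in> walks i t" for w
  proof -
    let ?S = "{l. l < m \<and> source t l = endpoint i w}"
    have "(\<Sum>l\<in>?S. if l \<in> set w then \<rho> else b l) \<le> (\<Sum>l\<in>?S. b l + (if l \<in> set w then \<rho> else 0))"
      using b \<rho> by (intro sum_mono) auto
    also have "\<dots> = (\<Sum>l\<in>?S. b l) + real (card (?S \<inter> set w)) * \<rho>"
      by (simp add: sum.distrib sum.If_cases Int_def)
    also have "(\<Sum>l\<in>?S. b l) \<le> \<beta>"
      using row[OF endpoint_less[OF i w]] col[OF endpoint_less[OF i w]]
      by (cases "even t") (simp_all add: source_def)
    also have "card (?S \<inter> set w) \<le> card (set w)" by (rule card_mono) auto
    also have "\<dots> \<le> T" using card_length[of w] length_walks[OF w] Suc.prems by simp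
    finally show ?thesis using \<rho> by (simp add: mult_right_mono)
  qed
  have "(\<Sum>w\<in>walks i (Suc t). weight \<rho> b w) = (\<Sum>w\<in>walks i t.
      (\<Sum>l | l < m \<and> source t l = endpoint i w. if l \<in> set w then \<rho> else b l) * weight \<rho> b w)"
    unfolding sum_walks_Suc by (simp add: sum_distrib_right)
  also have "\<dots> \<le> (\<Sum>w\<in>walks i t. (\<beta> + real T * \<rho>) * weight \<rho> b w)"
    using step weight set_walks by (intro sum_mono mult_right_mono) auto
  also have "\<dots> \<le> (\<beta> + real T * \<rho>) * (\<beta> + real T * \<rho>) ^ t"
    using Suc \<beta> \<rho> by (simp flip: sum_distrib_left add: mult_left_mono)
  finally show ?case by simp
qed simp

text \<open>The trace is a sum over closed walks. Independence turns the mean along a walk into a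
  product of moments, which its \<open>weight\<close> dominates, and \<open>sum_weight_le\<close>
  adds up the weights from each start.\<close>

lemma trace_moment:
  fixes p :: "nat \<Rightarrow> 'v pmf" and \<xi> :: "nat \<Rightarrow> 'v \<Rightarrow> real"
  assumes p: "\<And>l. l < m \<Longrightarrow> finite (set_pmf (p l))"
    and mom: "\<And>l k. l < m \<Longrightarrow> k \<ge> 1 \<Longrightarrow>
      \<bar>measure_pmf.expectation (p l) (\<lambda>v. \<xi> l v ^ k)\<bar> \<le> \<rho> ^ (k - 1) * b l"
    and \<rho>: "\<rho> \<ge> 0" and b: "\<And>l. l < m \<Longrightarrow> b l \<ge> 0"
    and row: "\<And>i. i < n \<Longrightarrow> (\<Sum>l | l < m \<and> r l = i. b l) \<le> \<beta>"
    and col: "\<And>j. j < n \<Longrightarrow> (\<Sum>l | l < m \<and> c l = j. b l) \<le> \<beta>"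
  shows "measure_pmf.expectation (Pi_pmf {..<m} d p)
      (\<lambda>\<sigma>. \<Sum>i<n. alternating (\<lambda>l. \<xi> l (\<sigma> l)) t $$ (i, i))
    \<le> real n * (\<beta> + real t * \<rho>) ^ t"
proof -
  let ?P = "Pi_pmf {..<m} d p"
  have "finite (set_pmf ?P)"
    using p by (intro finite_subset[OF set_Pi_pmf_subset'] finite_PiE_dflt) auto
  then have int: "integrable (measure_pmf ?P) f" for f :: "_ \<Rightarrow> real"
    by (rule integrable_measure_pmf_finite)
  have walk: "measure_pmf.expectation ?P (\<lambda>\<sigma>. \<Prod>l\<leftarrow>w. \<xi> l (\<sigma> l)) \<le> weight \<rho> b w"
    if w: "set w \<subseteq> {..<m}" for w
  proof -
    have "(\<Prod>l\<leftarrow>w. \<xi> l (\<sigma> l)) = (\<Prod>l<m. \<xi> l (\<sigma> l) ^ count_list w l)" for \<sigma>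
      using w by (intro prod_list_eq_prod_power) auto
    then have "measure_pmf.expectation ?P (\<lambda>\<sigma>. \<Prod>l\<leftarrow>w. \<xi> l (\<sigma> l))
        = (\<Prod>l<m. measure_pmf.expectation (p l) (\<lambda>v. \<xi> l v ^ count_list w l))"
      using p expectation_prod_Pi_pmf_finite[of "{..<m}" p d "\<lambda>l v. \<xi> l v ^ count_list w l"] by simp
    \<comment> \<open>Edges off the walk have exponent 0 and contribute the factor 1.\<close>
    also have "\<dots> = (\<Prod>l\<in>set w. measure_pmf.expectation (p l) (\<lambda>v. \<xi> l v ^ count_list w l))"
      using w by (intro prod.mono_neutral_right) auto
    also have "\<dots> \<le> (\<Prod>l\<in>set w. \<bar>measure_pmf.expectation (p l) (\<lambda>v. \<xi> l v ^ count_list w l)\<bar>)"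
      by (rule order_trans[OF abs_ge_self]) (simp add: abs_prod)
    also have "\<dots> \<le> (\<Prod>l\<in>set w. \<rho> ^ (count_list w l - 1) * b l)"
    proof (rule prod_mono, intro conjI)
      fix l assume l: "l \<in> set w"
      then have "count_list w l \<ge> 1" by (simp add: Suc_le_eq count_list_0_iff flip: neq0_conv)
      then show "\<bar>measure_pmf.expectation (p l) (\<lambda>v. \<xi> l v ^ count_list w l)\<bar>
          \<le> \<rho> ^ (count_list w l - 1) * b l"
        using l w by (intro mom) auto
    qed simp
    finally show ?thesis by (simp add: weight_eq)
  qed
  have weight: "weight \<rho> b w \<ge> 0" if "set w \<subseteq> {..<m}" for w
    using that \<rho> b by (induction w) auto
  have "measure_pmf.expectation ?P (\<lambda>\<sigma>. \<Sum>i<n. alternating (\<lambda>l. \<xi> l (\<sigma> l)) t $$ (i, i))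
      = (\<Sum>i<n. \<Sum>w | w \<in> walks i t \<and> endpoint i w = i.
          measure_pmf.expectation ?P (\<lambda>\<sigma>. \<Prod>l\<leftarrow>w. \<xi> l (\<sigma> l)))"
    by (simp add: alternating_entry int)
  also have "\<dots> \<le> (\<Sum>i<n. \<Sum>w | w \<in> walks i t \<and> endpoint i w = i. weight \<rho> b w)"
    using set_walks by (intro sum_mono walk) auto
  \<comment> \<open>Weights are nonnegative, so walks that do not close may be added.\<close>
  also have "\<dots> \<le> (\<Sum>i<n. \<Sum>w\<in>walks i t. weight \<rho> b w)"
    using set_walks weight finite_walks by (intro sum_mono sum_mono2) auto
  also have "\<dots> \<le> (\<Sum>i<n. (\<beta> + real t * \<rho>) ^ t)"
    using assms by (intro sum_mono sum_weight_le) auto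
  finally show ?thesis by simp
qed

end

section \<open>Operator norm and traces\<close>

unbundle no inner_syntax

lemma scalar_prod_Cauchy_Schwarz:
  assumes "x \<in> carrier_vec n" "y \<in> carrier_vec n"
  shows "x \<bullet> y \<le> eucl_norm x * eucl_norm y"
proof -
  have "(x \<bullet> y)\<^sup>2 \<le> (x \<bullet> x) * (y \<bullet> y)"
    using Cauchy_Schwarz_ineq_sum[of "\<lambda>i. x $ i" "\<lambda>i. y $ i" "{0..<n}"] assms
    by (simp add: scalar_prod_def power2_eq_square)
  then have "\<bar>x \<bullet> y\<bar> \<le> sqrt ((x \<bullet> x) * (y \<bullet> y))"
    by (metis real_sqrt_abs real_sqrt_le_iff)
  then show ?thesis by (simp add: eucl_norm_def real_sqrt_mult)
qed

lemma scalar_prod_self_nonneg: "(x :: real vec) \<bullet> x \<ge> 0"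
  by (simp add: scalar_prod_def sum_nonneg)

lemma eucl_norm_nonneg: "eucl_norm x \<ge> 0"
  by (simp add: eucl_norm_def scalar_prod_self_nonneg)

lemma eucl_norm_power2: "(eucl_norm x)\<^sup>2 = x \<bullet> x"
  by (simp add: eucl_norm_def scalar_prod_self_nonneg)

text \<open>The left side is the scalar product of \<open>x\<close> with
  \<open>E\<^sup>T E x\<close>, to which Cauchy-Schwarz applies.\<close>

lemma eucl_norm_Gram:
  assumes E: "E \<in> carrier_mat n n" and x: "x \<in> carrier_vec n" "eucl_norm x \<le> 1"
  shows "(eucl_norm (E *\<^sub>v x))\<^sup>2 \<le> eucl_norm (transpose_mat E * E *\<^sub>v x)"
proof -
  have "(eucl_norm (E *\<^sub>v x))\<^sup>2 = x \<bullet> (transpose_mat E *\<^sub>v (E *\<^sub>v x))"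
    using E x transpose_vec_mult_scalar[of "transpose_mat E" n n "E *\<^sub>v x" x]
    by (simp add: eucl_norm_power2)
  also have "transpose_mat E *\<^sub>v (E *\<^sub>v x) = transpose_mat E * E *\<^sub>v x"
    using E x by (simp add: assoc_mult_mat_vec[of _ n n _ n])
  also have "x \<bullet> \<dots> \<le> eucl_norm x * eucl_norm (transpose_mat E * E *\<^sub>v x)"
    using E x by (intro scalar_prod_Cauchy_Schwarz[of _ n]) auto
  also have "\<dots> \<le> eucl_norm (transpose_mat E * E *\<^sub>v x)"
    using x(2) eucl_norm_nonneg by (intro mult_left_le_one_le) auto
  finally show ?thesis .
qed

text \<open>The trace is the squared Frobenius norm of \<open>M\<close>, which dominates by
  Cauchy-Schwarz in each row.\<close>

lemma eucl_norm_mult_le_trace: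
  assumes M: "M \<in> carrier_mat n n" and x: "x \<in> carrier_vec n" "eucl_norm x \<le> 1"
  shows "(eucl_norm (M *\<^sub>v x))\<^sup>2 \<le> (\<Sum>i<n. (transpose_mat M * M) $$ (i, i))"
proof -
  have xx: "(\<Sum>j<n. (x $ j)\<^sup>2) \<le> 1"
  proof -
    have "(\<Sum>j<n. (x $ j)\<^sup>2) = (eucl_norm x)\<^sup>2"
      unfolding eucl_norm_power2 using x(1)
      by (simp add: scalar_prod_def power2_eq_square lessThan_atLeast0)
    also have "\<dots> \<le> 1" by (rule power_le_one[OF eucl_norm_nonneg x(2)])
    finally show ?thesis .
  qed
  have "(eucl_norm (M *\<^sub>v x))\<^sup>2 = (\<Sum>i<n. (\<Sum>j<n. M $$ (i, j) * x $ j)\<^sup>2)"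
    unfolding eucl_norm_power2 using M x
    by (simp add: scalar_prod_def power2_eq_square lessThan_atLeast0)
  also have "\<dots> \<le> (\<Sum>i<n. (\<Sum>j<n. (M $$ (i, j))\<^sup>2) * (\<Sum>j<n. (x $ j)\<^sup>2))"
    by (intro sum_mono Cauchy_Schwarz_ineq_sum)
  also have "\<dots> \<le> (\<Sum>i<n. (\<Sum>j<n. (M $$ (i, j))\<^sup>2))"
    using xx by (intro sum_mono mult_right_le_one_le sum_nonneg) (auto intro: sum_nonneg)
  also have "\<dots> = (\<Sum>i<n. (transpose_mat M * M) $$ (i, i))"
    using M by (subst sum.swap) (simp add: scalar_prod_def power2_eq_square lessThan_atLeast0)
  finally show ?thesis .
qed

lemma pow_mat_add:
  fixes S :: "real mat"
  assumes "S \<in> carrier_mat n n"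
  shows "S ^\<^sub>m (a + b) = S ^\<^sub>m a * S ^\<^sub>m b"
  using assms by (induction b) (auto simp flip: assoc_mult_mat[of _ n n _ n _ n])

lemma transpose_pow_mat:
  fixes S :: "real mat"
  assumes S: "S \<in> carrier_mat n n" and sym: "transpose_mat S = S"
  shows "transpose_mat (S ^\<^sub>m k) = S ^\<^sub>m k"
proof (induction k)
  case (Suc k)
  have "transpose_mat (S ^\<^sub>m Suc k) = S * S ^\<^sub>m k"
    using Suc sym S by (simp add: transpose_mult[of _ n n _ n])
  also have "\<dots> = S ^\<^sub>m Suc k"
    using pow_mat_add[OF S, of 1 k] S by simp
  finally show ?case .
qed (use S in simp)

text \<open>Avoids eigenvalues: \<open>eucl_norm_Gram\<close>, applied to the symmetric matrix
  \<open>S ^ (2 ^ k)\<close> with \<open>S = E\<^sup>T E\<close>, doubles the exponent, which is why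
  only powers of two occur. One last squaring passes to the trace.\<close>

lemma eucl_norm_power_le_trace:
  assumes E: "E \<in> carrier_mat n n" and x: "x \<in> carrier_vec n" "eucl_norm x \<le> 1"
  shows "eucl_norm (E *\<^sub>v x) ^ (4 * 2 ^ k) \<le>
    (\<Sum>i<n. ((transpose_mat E * E) ^\<^sub>m (2 * 2 ^ k)) $$ (i, i))"
proof -
  let ?S = "transpose_mat E * E"
  have S: "?S \<in> carrier_mat n n" and sym: "transpose_mat ?S = ?S"
    using E by (auto simp: transpose_mult[of _ n n _ n])
  have "eucl_norm (E *\<^sub>v x) ^ (2 * 2 ^ k) \<le> eucl_norm (?S ^\<^sub>m (2 ^ k) *\<^sub>v x)"
  proof (induction k)
    case 0
    show ?case using eucl_norm_Gram[OF E x] S by simp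
  next
    case (Suc k)
    let ?M = "?S ^\<^sub>m (2 ^ k)"
    have "eucl_norm (E *\<^sub>v x) ^ (2 * 2 ^ Suc k) = (eucl_norm (E *\<^sub>v x) ^ (2 * 2 ^ k))\<^sup>2"
      by (simp flip: power_mult add: mult.commute)
    also have "\<dots> \<le> (eucl_norm (?M *\<^sub>v x))\<^sup>2"
      using Suc by (intro power_mono) (auto simp: eucl_norm_nonneg)
    also have "\<dots> \<le> eucl_norm (transpose_mat ?M * ?M *\<^sub>v x)"
      by (rule eucl_norm_Gram[OF _ x]) (use S in simp)
    also have "transpose_mat ?M * ?M = ?S ^\<^sub>m (2 ^ Suc k)"
      unfolding transpose_pow_mat[OF S sym] by (simp flip: pow_mat_add[OF S] add: mult_2)
    finally show ?case .
  qed
  then have "(eucl_norm (E *\<^sub>v x) ^ (2 * 2 ^ k))\<^sup>2 \<le> (eucl_norm (?S ^\<^sub>m (2 ^ k) *\<^sub>v x))\<^sup>2"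
    by (intro power_mono) (auto simp: eucl_norm_nonneg)
  also have "\<dots> \<le> (\<Sum>i<n. (transpose_mat (?S ^\<^sub>m (2 ^ k)) * ?S ^\<^sub>m (2 ^ k)) $$ (i, i))"
    by (rule eucl_norm_mult_le_trace[OF _ x]) (use S in simp)
  also have "transpose_mat (?S ^\<^sub>m (2 ^ k)) * ?S ^\<^sub>m (2 ^ k) = ?S ^\<^sub>m (2 * 2 ^ k)"
    unfolding transpose_pow_mat[OF S sym] by (simp flip: pow_mat_add[OF S] add: mult_2)
  finally show ?thesis by (simp flip: power_mult add: mult.commute)
qed

section \<open>Random sampling\<close>

lemma bernoulli_pmf_ge_1:
  assumes "p \<ge> 1"
  shows "bernoulli_pmf p = return_pmf True"
proof (rule pmf_eqI)
  fix b
  have "pmf (bernoulli_pmf p) b = (if b then min 1 (max 0 p) else 1 - min 1 (max 0 p))"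
    by (simp add: bernoulli_pmf.rep_eq)
  with assms show "pmf (bernoulli_pmf p) b = pmf (return_pmf True) b" by (cases b) simp_all
qed

lemma expectation_bernoulli_clamp:
  fixes f :: "bool \<Rightarrow> real"
  assumes "p \<ge> 0"
  shows "measure_pmf.expectation (bernoulli_pmf p) f = f True * min 1 p + f False * (1 - min 1 p)"
  using assms by (cases "p \<le> 1") (simp_all add: bernoulli_pmf_ge_1)

text \<open>Input entry minus output entry. \<open>min 1 p\<close> is the actual success probability
  of the coin for \<open>p \<ge> 0\<close>, and the error has mean zero when
  \<open>p > 0\<close>.\<close>

definition noise :: "real \<Rightarrow> real \<Rightarrow> bool \<Rightarrow> real" where
  "noise p a v = a - of_bool v * (a / min 1 p)"

text \<open>The first moment of the error vanishes, which leaves room for a factor \<open>z ^ (k - 2)\<close> with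
  \<open>z \<ge> 1\<close>. Later, \<open>z\<close> balances first and repeated visits of an edge in a walk.\<close>

lemma noise_moment:
  assumes K: "K > 0" and z: "z \<ge> 1" and k: "k \<ge> 1" and p: "p = K * \<bar>a\<bar>"
  shows "\<bar>measure_pmf.expectation (bernoulli_pmf p) (\<lambda>v. noise p a v ^ k)\<bar>
    \<le> (z / K) ^ (k - 1) * (\<bar>a\<bar> / z)"
\<comment> \<open>In these cases the error vanishes almost surely.\<close>
proof (cases "a = 0 \<or> p \<ge> 1")
  case True
  have "measure_pmf.expectation (bernoulli_pmf p) (\<lambda>v. noise p a v ^ k) = 0"
  proof (cases "p \<ge> 1")
    case True
    then show ?thesis using k by (simp add: bernoulli_pmf_ge_1 noise_def)
  next
    case False
    then show ?thesis using True k by (simp add: noise_def)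
  qed
  then show ?thesis using K z by simp
next
  case False
  then have p01: "0 < p" "p < 1" and a: "\<bar>a\<bar> = p / K" using K p by auto
  have E: "measure_pmf.expectation (bernoulli_pmf p) (\<lambda>v. noise p a v ^ k)
      = p * (a - a / p) ^ k + (1 - p) * a ^ k"
    using p01 by (simp add: expectation_bernoulli_clamp noise_def mult.commute)
  have "a - a / p = - a / p * (1 - p)" using p01 by (simp add: field_simps)
  then have abs: "\<bar>a - a / p\<bar> = (1 - p) / K"
    using p01 K a by (simp add: abs_mult)
  show ?thesis
  proof (cases "k = 1")
    case True
    then show ?thesis using E K z p01 by (simp add: field_simps)
  next
    case False
    then obtain j where j: "k = Suc (Suc j)" using k by (metis One_nat_def Suc_le_D Suc_inject not0_implies_Suc)
    have "\<bar>p * (a - a / p) ^ k + (1 - p) * a ^ k\<bar> \<le> p * \<bar>a - a / p\<bar> ^ k + (1 - p) * \<bar>a\<bar> ^ k"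
      using p01 by (intro order_trans[OF abs_triangle_ineq]) (simp add: abs_mult power_abs)
    also have "\<dots> = p * (1 - p) / K ^ k * ((1 - p) ^ Suc j + p ^ Suc j)"
      unfolding abs a j by (simp add: power_divide distrib_left add_divide_distrib mult_ac)
    \<comment> \<open>As \<open>k \<ge> 2\<close>, each power in the last factor is at most its
      base, and the bases add up to 1.\<close>
    also have "\<dots> \<le> p * 1 / K ^ k * ((1 - p) + p)"
    proof (intro mult_mono divide_right_mono add_mono)
      show "(1 - p) ^ Suc j \<le> 1 - p" "p ^ Suc j \<le> p"
        using p01 by (auto intro!: mult_right_le_one_le power_le_one)
    qed (use p01 K in auto)
    also have "\<dots> = (1 / K) ^ Suc j * \<bar>a\<bar>"
      unfolding a j using K by (simp add: power_divide)
    also have "\<dots> \<le> (z ^ j) * ((1 / K) ^ Suc j * \<bar>a\<bar>)"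
      using z K mult_right_mono[of 1 "z ^ j" "(1 / K) ^ Suc j * \<bar>a\<bar>"] by simp
    also have "\<dots> = (z / K) ^ (k - 1) * (\<bar>a\<bar> / z)"
      using z unfolding j by (simp add: power_divide)
    finally show ?thesis unfolding E .
  qed
qed

section \<open>Tail bounds\<close>

lemma finite_set_Pi_bernoulli: "finite (set_pmf (Pi_pmf {..<m::nat} d (\<lambda>l. bernoulli_pmf (p l))))"
  by (intro finite_subset[OF set_Pi_pmf_subset'] finite_PiE_dflt) auto

lemma prob_le_Markov:
  fixes f :: "'a \<Rightarrow> real"
  assumes "finite (set_pmf P)" and "\<And>x. f x \<ge> 0" and "c > 0" and "\<And>x. Q x \<Longrightarrow> f x \<ge> c"
  shows "measure_pmf.prob P {x. Q x} \<le> measure_pmf.expectation P f / c"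
proof -
  have "measure_pmf.prob P {x. Q x} \<le> measure_pmf.prob P {x \<in> space (measure_pmf P). f x \<ge> c}"
    using assms(4) by (intro measure_pmf.finite_measure_mono) auto
  also have "\<dots> \<le> measure_pmf.expectation P f / c"
    using assms by (intro integral_Markov_inequality_measure[where A = UNIV] integrable_measure_pmf_finite) auto
  finally show ?thesis .
qed

text \<open>Chernoff bound with exponent 1: since \<open>exp 1 \<le> 3\<close>, a coin has
  exponential moment at most \<open>1 + 2 p \<le> exp (2 p)\<close>, and
  \<open>2 \<mu> - 3 \<mu> = - \<mu>\<close>.\<close>

lemma count_tail:
  assumes p: "\<And>l. l < m \<Longrightarrow> p l \<ge> 0" and \<mu>: "(\<Sum>l<m. p l) \<le> \<mu>"
  shows "measure_pmf.prob (Pi_pmf {..<m} False (\<lambda>l. bernoulli_pmf (p l)))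
    {\<sigma>. 3 * \<mu> < real (length (filter \<sigma> [0..<m]))} \<le> exp (- \<mu>)"
proof -
  let ?P = "Pi_pmf {..<m} False (\<lambda>l. bernoulli_pmf (p l))"
  have count: "exp (real (length (filter \<sigma> [0..<m]))) = (\<Prod>l<m. exp (of_bool (\<sigma> l)))" for \<sigma>
    by (induction m) (auto simp: exp_add mult.commute)
  have "measure_pmf.prob ?P {\<sigma>. 3 * \<mu> < real (length (filter \<sigma> [0..<m]))} \<le>
      measure_pmf.expectation ?P (\<lambda>\<sigma>. exp (real (length (filter \<sigma> [0..<m])))) / exp (3 * \<mu>)"
    by (rule prob_le_Markov) (auto simp: finite_set_Pi_bernoulli)
  also have "measure_pmf.expectation ?P (\<lambda>\<sigma>. exp (real (length (filter \<sigma> [0..<m])))) =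
      (\<Prod>l<m. measure_pmf.expectation (bernoulli_pmf (p l)) (\<lambda>v. exp (of_bool v)))"
    unfolding count by (rule expectation_prod_Pi_pmf_finite) auto
  also have "\<dots> \<le> (\<Prod>l<m. exp (2 * p l))"
  proof (rule prod_mono, intro conjI)
    fix l assume "l \<in> {..<m}"
    then have l: "p l \<ge> 0" using p by simp
    have "measure_pmf.expectation (bernoulli_pmf (p l)) (\<lambda>v. exp (of_bool v :: real))
        = 1 + (exp 1 - 1) * min 1 (p l)"
      using l by (simp add: expectation_bernoulli_clamp algebra_simps)
    also have "\<dots> \<le> 1 + 2 * p l"
      using l exp_le by (intro add_left_mono mult_mono) auto
    also have "\<dots> \<le> exp (2 * p l)" by (rule exp_ge_add_one_self)
    finally show "measure_pmf.expectation (bernoulli_pmf (p l)) (\<lambda>v. exp (of_bool v :: real)) \<le> exp (2 * p l)" .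
    show "0 \<le> measure_pmf.expectation (bernoulli_pmf (p l)) (\<lambda>v. exp (of_bool v :: real))"
      by (intro integral_nonneg_AE) auto
  qed
  also have "\<dots> = exp (2 * (\<Sum>l<m. p l))" by (simp add: exp_sum sum_distrib_left)
  also have "\<dots> \<le> exp (2 * \<mu>)" using \<mu> by simp
  finally show ?thesis by (simp add: divide_right_mono flip: exp_diff)
qed

text \<open>Serves to choose the order of the moment, which is restricted to multiples of powers of
  two.\<close>

lemma ex_power2_between:
  assumes "x \<ge> (1::real)"
  obtains k :: nat where "x \<le> 2 ^ k" "2 ^ k \<le> 2 * x"
proof -
  obtain j :: nat where "x < 2 ^ j" using real_arch_pow[of 2 x] by auto
  define k where "k = (LEAST k. x \<le> 2 ^ k)"
  have k: "x \<le> 2 ^ k" unfolding k_def by (rule LeastI[of _ j]) (use \<open>x < 2 ^ j\<close> in simp)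
  have "(2::real) ^ k \<le> 2 * x"
  proof (cases k)
    case (Suc i)
    then have "\<not> x \<le> 2 ^ i" using not_less_Least[of i "\<lambda>k. x \<le> 2 ^ k"] by (simp add: k_def)
    then show ?thesis using Suc by simp
  qed (use assms in simp)
  with k show ?thesis by (rule that)
qed

lemma op_norm_le:
  assumes "A \<in> carrier_mat n n"
    and "\<And>x. x \<in> carrier_vec n \<Longrightarrow> eucl_norm x \<le> 1 \<Longrightarrow> eucl_norm (A *\<^sub>v x) \<le> b"
  shows "op_norm A \<le> b"
  unfolding op_norm_def
proof (rule cSup_least)
  have "eucl_norm (0\<^sub>v n) \<le> 1" by (simp add: eucl_norm_def)
  then show "{eucl_norm (A *\<^sub>v v) |v. v \<in> carrier_vec (dim_col A) \<and> eucl_norm v \<le> 1} \<noteq> {}"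
    using assms(1) by (auto intro!: exI[of _ "0\<^sub>v n"])
qed (use assms in auto)

context edges
begin

text \<open>Markov's inequality for the trace of order \<open>t\<close>, with \<open>t\<close>
  between 12 and 24 times \<open>ln n\<close>. Its mean is at most \<open>n * (2 J / z) ^ t\<close>,
  and the rate makes \<open>(2 J / z)\<^sup>2 \<le> \<delta>\<^sup>2 / 4\<close>. What is left is
  \<open>n / 4 ^ q\<close>, at most \<open>1 / n\<^sup>2\<close>.\<close>

lemma sampling_error:
  assumes n: "n \<ge> 2" and K: "K > 0" and J: "J > 0" and \<delta>: "0 < \<delta>" "\<delta> \<le> J"
    and h: "ln (real n) \<le> h" and rate: "K * \<delta>\<^sup>2 \<ge> 400 * J * h"
    and row: "\<And>i. i < n \<Longrightarrow> (\<Sum>l | l < m \<and> r l = i. \<bar>a l\<bar>) \<le> J"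
    and col: "\<And>j. j < n \<Longrightarrow> (\<Sum>l | l < m \<and> c l = j. \<bar>a l\<bar>) \<le> J"
    and p: "\<And>l. p l = K * \<bar>a l\<bar>"
  shows "measure_pmf.prob (Pi_pmf {..<m} False (\<lambda>l. bernoulli_pmf (p l)))
    {\<sigma>. \<delta> < op_norm (edge_mat (\<lambda>l. noise (p l) (a l) (\<sigma> l)))} \<le> 1 / (2 * real n)"
proof -
  let ?P = "Pi_pmf {..<m} False (\<lambda>l. bernoulli_pmf (p l))"
  let ?E = "\<lambda>\<sigma>. edge_mat (\<lambda>l. noise (p l) (a l) (\<sigma> l))"
  have ln2: "ln 2 \<le> ln (real n)" using n by simp
  have ln_n: "ln (real n) \<ge> 2 / 3" using ln2_ge_two_thirds ln2 by linarith
  obtain k where k: "3 * ln (real n) \<le> 2 ^ k" "2 ^ k \<le> 2 * (3 * ln (real n))"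
    by (rule ex_power2_between[of "3 * ln (real n)"]) (use ln_n in auto)
  define q :: nat where "q = 2 * 2 ^ k"
  define t where "t = 2 * q"
  \<comment> \<open>Solves \<open>J / z = t * z / K\<close>, so that new and repeated edges cost the
    same.\<close>
  define z where "z = sqrt (J * K / t)"
  define trace where "trace = (\<lambda>\<sigma>. \<Sum>i<n. alternating (\<lambda>l. noise (p l) (a l) (\<sigma> l)) t $$ (i, i))"
  have t: "12 * ln (real n) \<le> real t" "real t \<le> 24 * ln (real n)" "t > 0"
    using k by (simp_all add: t_def q_def)
  \<comment> \<open>With \<open>\<delta> \<le> J\<close> the rate gives
    \<open>400 h \<le> J K\<close>; as \<open>t \<le> 24 h\<close>, this yields the condition
    \<open>z \<ge> 1\<close> of \<open>noise_moment\<close>.\<close>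
  have "400 * J * h \<le> K * \<delta>\<^sup>2" by (rule rate)
  also have "\<dots> \<le> K * J\<^sup>2" using K \<delta> by (intro mult_left_mono power_mono) auto
  finally have "J * (400 * h) \<le> J * (J * K)" by (simp add: power2_eq_square algebra_simps)
  then have JK: "400 * h \<le> J * K" using J by simp
  then have "real t \<le> J * K" using t h ln_n by linarith
  then have z: "z \<ge> 1" using t(3) by (simp add: z_def)
  have zz: "z * z = J * K / t" using J K by (simp add: z_def)
  have pow: "eucl_norm (?E \<sigma> *\<^sub>v x) ^ t \<le> trace \<sigma>"
    if "x \<in> carrier_vec n" "eucl_norm x \<le> 1" for \<sigma> x
  proof -
    have "eucl_norm (?E \<sigma> *\<^sub>v x) ^ t \<le> (\<Sum>i<n. ((transpose_mat (?E \<sigma>) * ?E \<sigma>) ^\<^sub>m q) $$ (i, i))"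
      using eucl_norm_power_le_trace[OF edge_mat_carrier that] by (simp add: t_def q_def mult.assoc)
    then show ?thesis by (simp add: trace_def t_def alternating_even)
  qed
  have trace: "trace \<sigma> \<ge> 0" for \<sigma>
  proof -
    have "eucl_norm (?E \<sigma> *\<^sub>v 0\<^sub>v n) ^ t \<le> trace \<sigma>"
      by (intro pow) (auto simp: eucl_norm_def)
    then show ?thesis using eucl_norm_nonneg by (meson order_trans zero_le_power)
  qed
  have "measure_pmf.prob ?P {\<sigma>. \<delta> < op_norm (?E \<sigma>)} \<le> measure_pmf.expectation ?P trace / \<delta> ^ t"
  proof (rule prob_le_Markov)
    fix \<sigma> assume \<sigma>: "\<delta> < op_norm (?E \<sigma>)"
    show "\<delta> ^ t \<le> trace \<sigma>"
    proof (rule ccontr)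
      assume "\<not> ?thesis"
      then have small: "trace \<sigma> < \<delta> ^ t" by simp
      have "op_norm (?E \<sigma>) \<le> \<delta>"
      proof (rule op_norm_le[OF edge_mat_carrier])
        fix x assume "x \<in> carrier_vec n" "eucl_norm x \<le> 1"
        from pow[OF this, of \<sigma>] small have "eucl_norm (?E \<sigma> *\<^sub>v x) ^ t < \<delta> ^ t" by simp
        then show "eucl_norm (?E \<sigma> *\<^sub>v x) \<le> \<delta>"
          using \<delta> by (meson less_imp_le power_less_imp_less_base)
      qed
      with \<sigma> show False by simp
    qed
  qed (use trace \<delta> finite_set_Pi_bernoulli in auto)
  also have "measure_pmf.expectation ?P trace \<le> real n * (J / z + real t * (z / K)) ^ t"
    unfolding trace_def
  proof (rule trace_moment[where b = "\<lambda>l. \<bar>a l\<bar> / z"])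
    show "\<bar>measure_pmf.expectation (bernoulli_pmf (p l)) (\<lambda>v. noise (p l) (a l) v ^ j)\<bar>
        \<le> (z / K) ^ (j - 1) * (\<bar>a l\<bar> / z)" if "j \<ge> 1" for l j
      by (rule noise_moment[OF K z that p])
    show "(\<Sum>l | l < m \<and> r l = i. \<bar>a l\<bar> / z) \<le> J / z" if "i < n" for i
      using row[OF that] z by (simp add: divide_right_mono flip: sum_divide_distrib)
    show "(\<Sum>l | l < m \<and> c l = i. \<bar>a l\<bar> / z) \<le> J / z" if "i < n" for i
      using col[OF that] z by (simp add: divide_right_mono flip: sum_divide_distrib)
  qed (use K z in auto)
  also have "J / z + real t * (z / K) = 2 * (J / z)"
  proof -
    have "real t * (z / K) = real t * (z * z) / (K * z)" using z by simp
    also have "\<dots> = J / z" unfolding zz using t K by simp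
    finally show ?thesis by simp
  qed
  also have "(2 * (J / z)) ^ t = (4 * J * t / K) ^ q"
  proof -
    have "(2 * (J / z)) * (2 * (J / z)) = 4 * (J * J) / (z * z)" by simp
    also have "\<dots> = 4 * J * t / K" unfolding zz using J K t by (simp add: field_simps)
    finally show ?thesis unfolding t_def power_mult power2_eq_square by simp
  qed
  also have "real n * (4 * J * t / K) ^ q / \<delta> ^ t = real n * (4 * J * t / (K * \<delta>\<^sup>2)) ^ q"
    by (simp add: t_def power_mult power_divide power_mult_distrib)
  also have "\<dots> \<le> real n * (1 / 4) ^ q"
  proof (intro mult_left_mono power_mono)
    \<comment> \<open>The constant 400 is large enough for \<open>4 * 24 * 4 = 384\<close>.\<close>
    have "4 * J * t \<le> 4 * J * (24 * h)" using t(2) h J by (intro mult_left_mono) auto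
    also have "\<dots> \<le> K * \<delta>\<^sup>2 / 4"
    proof -
      have "0 \<le> J * h" using J h ln_n by simp
      then show ?thesis using rate by simp
    qed
    finally show "4 * J * t / (K * \<delta>\<^sup>2) \<le> 1 / 4" using K \<delta> by (simp add: field_simps)
  qed (use J K in auto)
  \<comment> \<open>\<open>4 ^ q\<close> is \<open>2 ^ t\<close>, and \<open>t \<ge> 12 ln n\<close>
    makes this at least \<open>n ^ 3\<close>.\<close>
  also have "(1 / 4) ^ q \<le> 1 / (real n) ^ 3"
  proof -
    have "3 * ln (real n) \<le> real t * (2 / 3)" using t(1) ln_n by linarith
    also have "\<dots> \<le> real t * ln 2" using ln2_ge_two_thirds by (intro mult_left_mono) auto
    finally have "exp (3 * ln (real n)) \<le> exp (real t * ln 2)" by simp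
    moreover have "exp (3 * ln (real n)) = real n ^ 3"
      using n exp_of_nat_mult[of 3 "ln (real n)"] by simp
    moreover have "exp (real t * ln 2) = (2::real) ^ t" by (simp add: exp_of_nat_mult)
    ultimately have "real n ^ 3 \<le> 4 ^ q" by (simp add: t_def power_mult)
    then show ?thesis using n by (simp add: power_one_over frac_le)
  qed
  also have "real n * (1 / real n ^ 3) = 1 / (real n * real n)"
    using n by (simp add: power3_eq_cube)
  also have "\<dots> \<le> 1 / (2 * real n)"
    using n by (intro divide_left_mono mult_right_mono) auto
  finally show ?thesis using \<delta> by (simp add: divide_right_mono mult_left_mono)
qed

end

section \<open>The program\<close>

abbreviation "nat0 x \<equiv> NRead x (NConst 0)"
abbreviation "real0 x \<equiv> RRead x (NConst 0)"
abbreviation "idx \<equiv> nat0 ''i''"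
abbreviation "rconst k \<equiv> ROfNat (NConst k)"
abbreviation "incr x \<equiv> NAssign x (NConst 0) (NAdd (nat0 x) (NConst 1))"

text \<open>The maximum is updated as the row sums grow, which saves a pass over the rows. Indices
  start at 0, hence the denominator \<open>i + 1\<close> in the harmonic sum.\<close>

definition scan_body :: com where
  "scan_body =
    Seq (Cond (RLess (RRead ''val'' idx) (rconst 0))
          (RAssign ''abs'' idx (RSub (rconst 0) (RRead ''val'' idx)))
          (RAssign ''abs'' idx (RRead ''val'' idx)))
    (Seq (RAssign ''rowsum'' (NRead ''row'' idx)
          (RAdd (RRead ''rowsum'' (NRead ''row'' idx)) (RRead ''abs'' idx)))
    (Seq (Cond (RLess (real0 ''max'') (RRead ''rowsum'' (NRead ''row'' idx)))
          (RAssign ''max'' (NConst 0) (RRead ''rowsum'' (NRead ''row'' idx))) Skip)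
    (Seq (RAssign ''harm'' (NConst 0)
          (RAdd (real0 ''harm'') (RDiv (rconst 1) (ROfNat (NAdd idx (NConst 1))))))
      (incr ''i''))))"

definition loop :: "com \<Rightarrow> com" where
  "loop body = While (NLess idx (nat0 ''len'')) body"

text \<open>Meets the rate condition of \<open>sampling_error\<close> with equality for
  \<open>\<delta> = \<epsilon> N\<close>. For \<open>N = 0\<close> the division yields 0.\<close>

definition set_rate :: com where
  "set_rate = Seq (RAssign ''rate'' (NConst 0)
      (RDiv (RMul (RMul (rconst 400) (RAdd (real0 ''max'') (real0 ''norm''))) (real0 ''harm''))
        (RMul (RMul (real0 ''eps'') (real0 ''eps'')) (RMul (real0 ''norm'') (real0 ''norm'')))))
    (NAssign ''i'' (NConst 0) (NConst 0))"

text \<open>The truncated subtractions evaluate to 1 if there are at most as many listed entries as rows, in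
  which case everything is kept, and to 0 otherwise.\<close>

definition prob_exp :: rexp where
  "prob_exp = RAdd (RMul (real0 ''rate'') (RRead ''abs'' idx))
    (ROfNat (NSub (NConst 1) (NSub (nat0 ''len'') (nat0 ''dim''))))"

text \<open>All coins are stored before any output is written, so the rest of the run is
  deterministic given the outcomes.\<close>

definition toss_body :: com where
  "toss_body = Seq (Flip ''coin'' idx prob_exp) (incr ''i'')"

definition emit :: com where
  "emit = Seq (NAssign ''outrow'' (nat0 ''outlen'') (NRead ''row'' idx))
    (Seq (NAssign ''outcol'' (nat0 ''outlen'') (NRead ''col'' idx))
    (Seq (RAssign ''outval'' (nat0 ''outlen'') (RDiv (RRead ''val'' idx) (real0 ''prob'')))
      (incr ''outlen'')))"

definition write_body :: com where
  "write_body = Seq (RAssign ''prob'' (NConst 0) prob_exp)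
    (Seq (Cond (RLess (rconst 1) (real0 ''prob'')) (RAssign ''prob'' (NConst 0) (rconst 1)) Skip)
    (Seq (Cond (NLess (NConst 0) (NRead ''coin'' idx)) emit Skip)
      (incr ''i'')))"

text \<open>A disjunction in de Morgan form. For \<open>n = 1\<close> the bound on the non-zero
  entries is 0, as \<open>ln 1 = 0\<close>, so the output must be empty; otherwise the threshold is
  that of \<open>count_tail\<close>.\<close>

definition cut_off :: com where
  "cut_off = Cond (BNot (BAnd (BNot (NLess (nat0 ''dim'') (NConst 2)))
      (BNot (BAnd (NLess (nat0 ''dim'') (nat0 ''len''))
        (RLess (RMul (RMul (rconst 3) (real0 ''rate''))
            (RMul (ROfNat (nat0 ''dim'')) (RAdd (real0 ''max'') (real0 ''norm''))))
          (ROfNat (nat0 ''outlen'')))))))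
    (NAssign ''outlen'' (NConst 0) (NConst 0)) Skip"

definition sparsify :: com where
  "sparsify = Seq (Seq (loop scan_body) set_rate) (Seq (loop toss_body)
    (Seq (NAssign ''i'' (NConst 0) (NConst 0)) (Seq (loop write_body) cut_off)))"

lemma straight_bodies:
  "straight scan_body" "straight set_rate" "straight write_body" "straight cut_off"
  by (simp_all add: scan_body_def set_rate_def write_body_def emit_def cut_off_def)

lemma cost_bodies:
  "cost scan_body = 7" "cost set_rate = 2" "cost write_body = 9" "cost cut_off = 2"
  by (simp_all add: scan_body_def set_rate_def write_body_def emit_def cut_off_def)

section \<open>Correctness and running time of the program\<close>

locale input =
  fixes n m :: nat and r c :: "nat \<Rightarrow> nat" and a :: "nat \<Rightarrow> real" and N e :: real
begin

definition input :: "state \<Rightarrow> bool" where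
  "input s \<longleftrightarrow> nmem s ''dim'' 0 = n \<and> nmem s ''len'' 0 = m \<and>
    (\<forall>k<m. nmem s ''row'' k = r k \<and> nmem s ''col'' k = c k \<and> rmem s ''val'' k = a k) \<and>
    rmem s ''norm'' 0 = N \<and> rmem s ''eps'' 0 = e \<and> nmem s ''outlen'' 0 = 0"

text \<open>The running maximum is only pinned between the partial row sums and \<open>b\<close>.
  These two bounds suffice for the analysis, so it is not identified with
  \<open>inf_norm\<close>.\<close>

definition scanned :: "real \<Rightarrow> nat \<Rightarrow> state \<Rightarrow> bool" where
  "scanned b k s \<longleftrightarrow> input s \<and> nmem s ''i'' 0 = k \<and> (\<forall>l<k. rmem s ''abs'' l = \<bar>a l\<bar>) \<and>
    (\<forall>i. rmem s ''rowsum'' i = (\<Sum>l<k. if r l = i then \<bar>a l\<bar> else 0)) \<and>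
    (\<forall>i. rmem s ''rowsum'' i \<le> rmem s ''max'' 0) \<and> rmem s ''max'' 0 \<le> b \<and>
    rmem s ''harm'' 0 = harm k"

lemma scan_step:
  assumes b: "\<And>i. (\<Sum>l<m. if r l = i then \<bar>a l\<bar> else 0) \<le> b"
    and k: "k < m" and s: "scanned b k s"
  shows "scanned b (Suc k) (exec scan_body s)"
proof -
  \<comment> \<open>Partial row sums only grow, so the updated one stays below
    \<open>b\<close>.\<close>
  have "(\<Sum>l<Suc k. if r l = r k then \<bar>a l\<bar> else 0) \<le> (\<Sum>l<m. if r l = r k then \<bar>a l\<bar> else 0)"
    using k by (intro sum_mono2) auto
  then have "(\<Sum>l<k. if r l = r k then \<bar>a l\<bar> else 0) + \<bar>a k\<bar> \<le> b"
    using b[of "r k"] by simp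
  then have R: "rmem s ''rowsum'' (r k) + \<bar>a k\<bar> \<le> b"
    using s by (simp add: scanned_def)
  have v: "nmem s ''i'' 0 = k" "nmem s ''row'' k = r k" "rmem s ''val'' k = a k"
    using s k by (simp_all add: scanned_def input_def)
  let ?s = "exec scan_body s"
  have nat_cells: "nmem ?s = (nmem s)(''i'' := (nmem s ''i'')(0 := Suc k))"
    by (simp add: scan_body_def nupd_def rupd_def v)
  have real_cells: "rmem ?s ''val'' = rmem s ''val''" "rmem ?s ''norm'' = rmem s ''norm''"
    "rmem ?s ''eps'' = rmem s ''eps''" "rmem ?s ''abs'' = (rmem s ''abs'')(k := \<bar>a k\<bar>)"
    "rmem ?s ''rowsum'' = (rmem s ''rowsum'')(r k := rmem s ''rowsum'' (r k) + \<bar>a k\<bar>)"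
    "rmem ?s ''max'' 0 = max (rmem s ''max'' 0) (rmem s ''rowsum'' (r k) + \<bar>a k\<bar>)"
    "rmem ?s ''harm'' 0 = rmem s ''harm'' 0 + 1 / real (Suc k)"
    by (simp_all add: scan_body_def nupd_def rupd_def v)
  show ?thesis
    unfolding scanned_def
  proof (intro conjI allI impI)
    show "input ?s" using s by (simp add: scanned_def input_def nat_cells real_cells)
    show "rmem ?s ''rowsum'' i = (\<Sum>l<Suc k. if r l = i then \<bar>a l\<bar> else 0)" for i
      using s by (simp add: scanned_def real_cells)
    show "rmem ?s ''rowsum'' i \<le> rmem ?s ''max'' 0" for i
      using s by (cases "i = r k") (auto simp: scanned_def real_cells le_max_iff_disj)
    show "rmem ?s ''max'' 0 \<le> b" using s R by (simp add: scanned_def real_cells)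
  qed (use s in \<open>auto simp: scanned_def nat_cells real_cells harm_Suc inverse_eq_divide less_Suc_eq\<close>)
qed

definition rate :: "real \<Rightarrow> real" where
  "rate M = 400 * (M + N) * harm m / (e * e * (N * N))"

definition prob :: "real \<Rightarrow> nat \<Rightarrow> real" where
  "prob K l = K * \<bar>a l\<bar> + real (1 - (m - n))"

definition ready :: "real \<Rightarrow> state \<Rightarrow> bool" where
  "ready M s \<longleftrightarrow> input s \<and> (\<forall>l<m. rmem s ''abs'' l = \<bar>a l\<bar>) \<and>
    rmem s ''max'' 0 = M \<and> rmem s ''rate'' 0 = rate M"

lemma runs_scan:
  assumes s: "input s" "\<And>i. rmem s ''rowsum'' i = 0" "rmem s ''max'' 0 = 0"
      "rmem s ''harm'' 0 = 0" "nmem s ''i'' 0 = 0"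
    and b: "\<And>i. (\<Sum>l<m. if r l = i then \<bar>a l\<bar> else 0) \<le> b"
  shows "\<exists>s' M. runs (Seq (loop scan_body) set_rate) s (return_pmf s') (m * 8 + 3) \<and>
    ready M s' \<and> nmem s' ''i'' 0 = 0 \<and> M \<le> b \<and>
    (\<forall>i. (\<Sum>l<m. if r l = i then \<bar>a l\<bar> else 0) \<le> M)"
proof -
  have "0 \<le> (\<Sum>l<m. if r l = 0 then \<bar>a l\<bar> else 0)" by (intro sum_nonneg) auto
  then have "0 \<le> b" using b[of 0] by linarith
  then have init: "scanned b 0 s" using s by (simp add: scanned_def harm_expand)
  have "\<exists>s'. runs (loop scan_body) s (return_pmf s') (m * Suc (cost scan_body) + 1) \<and> scanned b m s'"
    unfolding loop_def
  proof (rule runs_While_straight[where I = "scanned b"])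
    fix k s assume "k < m" "scanned b k s"
    then show "beval (NLess idx (nat0 ''len'')) s \<and> scanned b (Suc k) (exec scan_body s)"
      by (intro conjI scan_step[OF b]) (auto simp: scanned_def input_def)
  qed (use init in \<open>auto simp: straight_bodies scanned_def input_def\<close>)
  then obtain s' where s': "runs (loop scan_body) s (return_pmf s') (m * 8 + 1)" "scanned b m s'"
    by (auto simp: cost_bodies)
  let ?t = "exec set_rate s'"
  have "runs (Seq (loop scan_body) set_rate) s (return_pmf ?t) (m * 8 + 3)"
    by (rule runs_mono[OF runs_Seq_return[OF s'(1) runs_straight]])
      (simp_all add: straight_bodies cost_bodies)
  moreover have "ready (rmem s' ''max'' 0) ?t \<and> nmem ?t ''i'' 0 = 0"
    using s'(2)
    by (simp add: scanned_def ready_def input_def rate_def set_rate_def nupd_def rupd_def)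
  moreover have "rmem s' ''max'' 0 \<le> b"
    "\<forall>i. (\<Sum>l<m. if r l = i then \<bar>a l\<bar> else 0) \<le> rmem s' ''max'' 0"
    using s'(2) by (auto simp: scanned_def)
  ultimately show ?thesis by blast
qed

text \<open>An explicit state rather than an invariant: the law after the loop has to be an image of
  the coin law. Cells from \<open>k\<close> on keep their old content, so only tossed coins
  matter.\<close>

definition tossed :: "state \<Rightarrow> nat \<Rightarrow> (nat \<Rightarrow> bool) \<Rightarrow> state" where
  "tossed s k \<sigma> = s\<lparr>nmem := (nmem s)(
      ''coin'' := (\<lambda>i. if i < k then of_bool (\<sigma> i) else nmem s ''coin'' i),
      ''i'' := (nmem s ''i'')(0 := k))\<rparr>"

lemma prob_exp_eval:
  "input s \<Longrightarrow> rmem s ''abs'' l = \<bar>a l\<bar> \<Longrightarrow> nmem s ''i'' 0 = l \<Longrightarrow>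
    reval prob_exp s = prob (rmem s ''rate'' 0) l"
  by (simp add: prob_exp_def prob_def input_def)

lemma runs_toss:
  assumes s: "ready M s" "nmem s ''i'' 0 = 0"
  shows "runs (loop toss_body) s
    (map_pmf (tossed s m) (Pi_pmf {..<m} False (\<lambda>l. bernoulli_pmf (prob (rate M) l)))) (m * 3 + 1)"
proof -
  have step: "runs toss_body (tossed s k \<sigma>)
      (map_pmf (\<lambda>x. tossed s (Suc k) (\<sigma>(k := x))) (bernoulli_pmf (prob (rate M) k))) 2"
    if k: "k < m" for k \<sigma>
  proof -
    let ?s = "tossed s k \<sigma>"
    have i: "nmem ?s ''i'' 0 = k" by (simp add: tossed_def)
    have "reval prob_exp ?s = prob (rmem ?s ''rate'' 0) k"
      using s k by (intro prob_exp_eval) (auto simp: ready_def input_def tossed_def)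
    then have p: "reval prob_exp ?s = prob (rate M) k"
      using s by (simp add: ready_def tossed_def)
    have upd: "exec (incr ''i'') (nupd ''coin'' k (of_bool x) ?s) = tossed s (Suc k) (\<sigma>(k := x))" for x
      by (auto simp: nupd_def tossed_def fun_eq_iff)
    have "runs toss_body ?s (bind_pmf (bernoulli_pmf (reval prob_exp ?s))
        (\<lambda>x. return_pmf (tossed s (Suc k) (\<sigma>(k := x))))) (1 + 1)"
      unfolding toss_body_def
    proof (rule runs_Seq_map[OF runs_Flip])
      fix x
      show "runs (incr ''i'') (nupd ''coin'' (neval idx ?s) (of_bool x) ?s)
          (return_pmf (tossed s (Suc k) (\<sigma>(k := x)))) 1"
        using runs_straight[of "incr ''i''" "nupd ''coin'' k (of_bool x) ?s"] i
        unfolding upd by simp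
    qed
    then show ?thesis unfolding p by (simp add: map_pmf_def numeral_2_eq_2)
  qed
  \<comment> \<open>Before the first toss any outcome function describes the state.\<close>
  have s0: "tossed s 0 undefined = s" using s(2) by (simp add: tossed_def fun_upd_idem)
  have "runs (loop toss_body) (tossed s 0 undefined)
    (map_pmf (tossed s m) (Pi_pmf {..<m} False (\<lambda>l. bernoulli_pmf (prob (rate M) l)))) (m * Suc 2 + 1)"
    unfolding loop_def
  proof (rule runs_While_coins, intro conjI)
    show "beval (NLess idx (nat0 ''len'')) (tossed s k \<sigma>)" if "k < m" for k \<sigma>
      using that s by (simp add: tossed_def ready_def input_def)
    show "\<not> beval (NLess idx (nat0 ''len'')) (tossed s m \<sigma>)" for \<sigma>
      using s by (simp add: tossed_def ready_def input_def)
    show "tossed s m \<sigma> = tossed s m \<sigma>'" if "\<And>i. i < m \<Longrightarrow> \<sigma> i = \<sigma>' i" for \<sigma> \<sigma>'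
      using that by (auto simp: tossed_def cong: if_cong)
  qed (rule step)
  then show ?thesis by (simp add: s0)
qed

definition kept :: "real \<Rightarrow> (nat \<Rightarrow> bool) \<Rightarrow> nat \<Rightarrow> entries" where
  "kept M \<sigma> k = map (\<lambda>l. (r l, c l, a l / min 1 (prob (rate M) l))) (filter \<sigma> [0..<k])"

text \<open>\<open>input\<close> demands an empty output, which fails while writing;
  \<open>ready\<close> is therefore stated for a copy with \<open>outlen\<close> reset.\<close>

definition written :: "real \<Rightarrow> (nat \<Rightarrow> bool) \<Rightarrow> nat \<Rightarrow> state \<Rightarrow> bool" where
  "written M \<sigma> k s \<longleftrightarrow> (let t = nupd ''outlen'' 0 0 s in ready M t) \<and> nmem s ''i'' 0 = k \<and>
    (\<forall>l<m. nmem s ''coin'' l = of_bool (\<sigma> l)) \<and> output_entries s = kept M \<sigma> k"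

lemma output_entries_snoc:
  assumes "nmem s' ''outlen'' 0 = Suc q" "q = nmem s ''outlen'' 0"
    and "nmem s' ''outrow'' = (nmem s ''outrow'')(q := i)"
    and "nmem s' ''outcol'' = (nmem s ''outcol'')(q := j)"
    and "rmem s' ''outval'' = (rmem s ''outval'')(q := x)"
  shows "output_entries s' = output_entries s @ [(i, j, x)]"
  using assms by (simp add: output_entries_def)

lemma write_step:
  assumes k: "k < m" and s: "written M \<sigma> k s"
  shows "written M \<sigma> (Suc k) (exec write_body s)"
proof -
  let ?s = "nupd ''outlen'' 0 0 s"
  \<comment> \<open>\<open>prob_exp\<close> does not read \<open>outlen\<close>, so it may be
    evaluated in the reset copy.\<close>
  have "reval prob_exp ?s = prob (rmem ?s ''rate'' 0) k"
    using s k by (intro prob_exp_eval) (auto simp: written_def ready_def input_def nupd_def Let_def)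
  then have p: "reval prob_exp s = prob (rate M) k"
    using s by (simp add: written_def ready_def nupd_def prob_exp_def Let_def)
  let ?x = "a k / min 1 (prob (rate M) k)"
  have val: "rmem s ''val'' k = a k" "nmem s ''row'' k = r k" "nmem s ''col'' k = c k"
    "nmem s ''i'' 0 = k" "nmem s ''coin'' k = of_bool (\<sigma> k)"
    using s k by (auto simp: written_def ready_def input_def nupd_def Let_def)
  let ?s' = "exec write_body s"
  have nat_cells: "nmem ?s' ''dim'' = nmem s ''dim''" "nmem ?s' ''len'' = nmem s ''len''"
    "nmem ?s' ''row'' = nmem s ''row''" "nmem ?s' ''col'' = nmem s ''col''"
    "nmem ?s' ''coin'' = nmem s ''coin''" "nmem ?s' ''i'' 0 = Suc k"
    by (simp_all add: write_body_def emit_def nupd_def rupd_def val)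
  have real_cells: "rmem ?s' ''val'' = rmem s ''val''" "rmem ?s' ''norm'' = rmem s ''norm''"
    "rmem ?s' ''eps'' = rmem s ''eps''" "rmem ?s' ''abs'' = rmem s ''abs''"
    "rmem ?s' ''max'' = rmem s ''max''" "rmem ?s' ''rate'' = rmem s ''rate''"
    by (simp_all add: write_body_def emit_def nupd_def rupd_def)
  have "output_entries ?s' = output_entries s @ (if \<sigma> k then [(r k, c k, ?x)] else [])"
  proof (cases "\<sigma> k")
    case True
    have "output_entries ?s' = output_entries s @ [(r k, c k, ?x)]"
    proof (rule output_entries_snoc[OF _ refl])
      show "rmem ?s' ''outval'' = (rmem s ''outval'')(nmem s ''outlen'' 0 := ?x)"
        by (simp add: write_body_def emit_def nupd_def rupd_def p val True)
    qed (simp_all add: write_body_def emit_def nupd_def rupd_def val True)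
    then show ?thesis using True by simp
  next
    case False
    have "nmem ?s' ''outlen'' = nmem s ''outlen''" "nmem ?s' ''outrow'' = nmem s ''outrow''"
      "nmem ?s' ''outcol'' = nmem s ''outcol''" "rmem ?s' ''outval'' = rmem s ''outval''"
      by (simp_all add: write_body_def nupd_def rupd_def val False)
    then show ?thesis using False by (simp add: output_entries_def)
  qed
  moreover have "ready M (nupd ''outlen'' 0 0 ?s')"
    using s by (simp add: written_def Let_def ready_def input_def nupd_def nat_cells real_cells)
  ultimately show ?thesis
    using s by (simp add: written_def Let_def kept_def nat_cells)
qed

definition result :: "real \<Rightarrow> (nat \<Rightarrow> bool) \<Rightarrow> entries" where
  "result M \<sigma> = (if n < 2 \<or> n < m \<and> 3 * rate M * (real n * (M + N)) < real (length (kept M \<sigma> m))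
    then [] else kept M \<sigma> m)"

lemma runs_write:
  assumes s: "ready M s"
  shows "\<exists>s'. runs (Seq (NAssign ''i'' (NConst 0) (NConst 0)) (Seq (loop write_body) cut_off))
      (tossed s m \<sigma>) (return_pmf s') (m * 10 + 4) \<and> output_entries s' = result M \<sigma>"
proof -
  let ?s = "nupd ''i'' 0 0 (tossed s m \<sigma>)"
  have i: "runs (NAssign ''i'' (NConst 0) (NConst 0)) (tossed s m \<sigma>) (return_pmf ?s) 1"
    using runs_NAssign[of "''i''" "NConst 0" "NConst 0" "tossed s m \<sigma>"] by simp
  have init: "written M \<sigma> 0 ?s"
    using s by (auto simp: written_def Let_def ready_def input_def nupd_def tossed_def kept_def output_entries_def)
  have "\<exists>s'. runs (loop write_body) ?s (return_pmf s') (m * Suc (cost write_body) + 1) \<and> written M \<sigma> m s'"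
    unfolding loop_def
  proof (rule runs_While_straight[where I = "written M \<sigma>"])
    fix k s assume "k < m" "written M \<sigma> k s"
    then show "beval (NLess idx (nat0 ''len'')) s \<and> written M \<sigma> (Suc k) (exec write_body s)"
      by (intro conjI write_step) (auto simp: written_def ready_def input_def nupd_def Let_def)
  qed (use init in \<open>auto simp: straight_bodies written_def ready_def input_def nupd_def Let_def\<close>)
  then obtain s' where s': "runs (loop write_body) ?s (return_pmf s') (m * 10 + 1)" "written M \<sigma> m s'"
    by (auto simp: cost_bodies)
  let ?t = "exec cut_off s'"
  have t: "runs cut_off s' (return_pmf ?t) 2"
    using runs_straight[OF straight_bodies(4)] by (simp add: cost_bodies)
  have "runs (Seq (NAssign ''i'' (NConst 0) (NConst 0)) (Seq (loop write_body) cut_off))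
      (tossed s m \<sigma>) (return_pmf ?t) (m * 10 + 4)"
    by (rule runs_mono[OF runs_Seq_return[OF i runs_Seq_return[OF s'(1) t]]]) simp
  moreover have "output_entries ?t = result M \<sigma>"
  proof -
    have kept: "output_entries s' = kept M \<sigma> m" using s'(2) by (simp add: written_def)
    have "nmem s' ''outlen'' 0 = length (output_entries s')" by (simp add: output_entries_def)
    moreover have "nmem s' ''dim'' 0 = n" "nmem s' ''len'' 0 = m" "rmem s' ''rate'' 0 = rate M"
      "rmem s' ''max'' 0 = M" "rmem s' ''norm'' 0 = N"
      using s'(2) by (auto simp: written_def ready_def input_def nupd_def Let_def)
    moreover have "output_entries (nupd ''outlen'' 0 0 s') = []"
      by (simp add: output_entries_def nupd_def)
    ultimately show ?thesis unfolding cut_off_def result_def by (simp add: kept)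
  qed
  ultimately show ?thesis by blast
qed

text \<open>The scan is deterministic, so \<open>M\<close> is a fixed number before the coins are
  tossed and the final state is a function of their outcomes.\<close>

lemma runs_sparsify:
  assumes s: "input s" "\<And>i. rmem s ''rowsum'' i = 0" "rmem s ''max'' 0 = 0"
      "rmem s ''harm'' 0 = 0" "nmem s ''i'' 0 = 0"
    and b: "\<And>i. (\<Sum>l<m. if r l = i then \<bar>a l\<bar> else 0) \<le> b"
  obtains M g where "M \<le> b" "\<And>i. (\<Sum>l<m. if r l = i then \<bar>a l\<bar> else 0) \<le> M"
    "\<And>\<sigma>. output_entries (g \<sigma>) = result M \<sigma>"
    "runs sparsify s
      (map_pmf g (Pi_pmf {..<m} False (\<lambda>l. bernoulli_pmf (prob (rate M) l)))) (m * 21 + 8)"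
proof -
  obtain s' M where s': "runs (Seq (loop scan_body) set_rate) s (return_pmf s') (m * 8 + 3)"
    "ready M s'" "nmem s' ''i'' 0 = 0" and M: "M \<le> b" "\<And>i. (\<Sum>l<m. if r l = i then \<bar>a l\<bar> else 0) \<le> M"
    using runs_scan[OF s b] by blast
  obtain g where g: "\<And>\<sigma>. runs (Seq (NAssign ''i'' (NConst 0) (NConst 0)) (Seq (loop write_body) cut_off))
      (tossed s' m \<sigma>) (return_pmf (g \<sigma>)) (m * 10 + 4) \<and> output_entries (g \<sigma>) = result M \<sigma>"
    using runs_write[OF s'(2)] by metis
  have "runs sparsify s (bind_pmf (Pi_pmf {..<m} False (\<lambda>l. bernoulli_pmf (prob (rate M) l)))
      (\<lambda>\<sigma>. return_pmf (g \<sigma>))) (m * 8 + 3 + (m * 3 + 1 + (m * 10 + 4)))"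
    unfolding sparsify_def
    by (rule runs_Seq_return[OF s'(1) runs_Seq_map[OF runs_toss[OF s'(2,3)]]]) (use g in blast)
  moreover have "m * 8 + 3 + (m * 3 + 1 + (m * 10 + 4)) = m * 21 + 8" by simp
  ultimately have "runs sparsify s
      (map_pmf g (Pi_pmf {..<m} False (\<lambda>l. bernoulli_pmf (prob (rate M) l)))) (m * 21 + 8)"
    by (simp only: map_pmf_def)
  then show ?thesis using g M by (intro that[of M g]) blast+
qed

end

section \<open>Entry lists\<close>

lemma mat_of_entries_map:
  assumes "i < n" "j < n"
  shows "mat_of_entries n (map (\<lambda>l. (r l, c l, x l)) (filter P [0..<m])) $$ (i, j) =
    (\<Sum>l | l < m \<and> r l = i \<and> c l = j. of_bool (P l) * x l)"
proof -
  have "mat_of_entries n (map (\<lambda>l. (r l, c l, x l)) (filter P [0..<m])) $$ (i, j) =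
      (\<Sum>l\<leftarrow>filter P [0..<m]. if r l = i \<and> c l = j then x l else 0)"
    using assms by (simp add: mat_of_entries_def o_def)
  also have "\<dots> = (\<Sum>l<m. if P l then if r l = i \<and> c l = j then x l else 0 else 0)"
    by (simp add: sum_list_map_filter' interv_sum_list_conv_sum_set_nat lessThan_atLeast0)
  also have "\<dots> = (\<Sum>l<m. if r l = i \<and> c l = j then of_bool (P l) * x l else 0)"
    by (intro sum.cong) auto
  also have "\<dots> = (\<Sum>l\<in>{l\<in>{..<m}. r l = i \<and> c l = j}. of_bool (P l) * x l)"
    by (rule sum.inter_filter[symmetric]) simp
  finally show ?thesis by simp
qed

text \<open>A position that is not listed carries a sum of zeros.\<close>

lemma nnz_mat_of_entries_le: "nnz (mat_of_entries n es) \<le> length es"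
proof -
  have "{(i, j). i < n \<and> j < n \<and> mat_of_entries n es $$ (i, j) \<noteq> 0} \<subseteq> (\<lambda>(i, j, x). (i, j)) ` set es"
  proof clarify
    fix i j assume ij: "i < n" "j < n" "mat_of_entries n es $$ (i, j) \<noteq> 0"
    show "(i, j) \<in> (\<lambda>(i, j, x). (i, j)) ` set es"
    proof (rule ccontr)
      assume "(i, j) \<notin> (\<lambda>(i, j, x). (i, j)) ` set es"
      then have "(\<Sum>(i', j', x)\<leftarrow>es. if i' = i \<and> j' = j then x else 0) = (\<Sum>_\<leftarrow>es. 0)"
        by (intro arg_cong[where f = sum_list] map_cong refl) force
      then show False using ij by (simp add: mat_of_entries_def)
    qed
  qed
  then have "nnz (mat_of_entries n es) \<le> card ((\<lambda>(i, j, x). (i, j)) ` set es)"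
    unfolding nnz_def by (intro card_mono) (auto simp: mat_of_entries_def)
  also have "\<dots> \<le> length es"
    by (rule order_trans[OF card_image_le card_length]) simp
  finally show ?thesis .
qed

lemma inf_norm_ge:
  assumes "A \<in> carrier_mat n n" "i < n"
  shows "(\<Sum>j<n. \<bar>A $$ (i, j)\<bar>) \<le> inf_norm A"
  using assms unfolding inf_norm_def by (intro Max_ge) auto

lemma op_norm_zero_le:
  assumes "A \<in> carrier_mat n n" "\<And>i j. i < n \<Longrightarrow> j < n \<Longrightarrow> A $$ (i, j) = 0"
  shows "op_norm A \<le> 0"
proof (rule op_norm_le[OF assms(1)])
  fix x :: "real vec" assume x: "x \<in> carrier_vec n"
  have "A = 0\<^sub>m n n" using assms by (intro eq_matI) auto
  moreover have "0\<^sub>m n n *\<^sub>v x = 0\<^sub>v n" using x by (intro eq_vecI) auto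
  ultimately show "eucl_norm (A *\<^sub>v x) \<le> 0" by (simp add: eucl_norm_def)
qed

text \<open>The difference \<open>harm m - ln m\<close> decreases from its value 1 at
  \<open>m = 1\<close>.\<close>

lemma harm_le_ln:
  assumes "m \<ge> 1"
  shows "harm m \<le> 1 + ln (real m)"
  using euler_mascheroni_sequence_decreasing[of 1 m] assms by (simp add: harm_expand)

section \<open>The sparsified matrix\<close>

locale sparsification = input n m r c a N e + edges n m r c
  for n m r c a N e +
  fixes \<theta> :: real
  assumes inj: "inj_on (\<lambda>l. (r l, c l)) {..<m}"
    and n1: "n \<ge> 1" and N: "N = op_norm (edge_mat a)" and sdd: "SDD \<theta> (edge_mat a)"
    and \<theta>: "\<theta> \<ge> 1" and e: "0 < e" "e < 1"
begin

text \<open>By injectivity at most one edge sits at a position, so nothing cancels.\<close>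

lemma abs_entry:
  assumes "i < n" "j < n"
  shows "\<bar>edge_mat a $$ (i, j)\<bar> = (\<Sum>l | l < m \<and> r l = i \<and> c l = j. \<bar>a l\<bar>)"
proof -
  let ?S = "{l. l < m \<and> r l = i \<and> c l = j}"
  have S: "edge_mat a $$ (i, j) = sum a ?S" using assms by (simp add: edge_mat_def)
  show ?thesis
  proof (cases "?S = {}")
    case False
    then obtain l where "l \<in> ?S" by blast
    then have "?S = {l}" using inj unfolding inj_on_def by auto
    then show ?thesis unfolding S by simp
  next
    case True
    show ?thesis unfolding S True by simp
  qed
qed

lemma row_sum:
  assumes "i < n"
  shows "(\<Sum>l | l < m \<and> r l = i. \<bar>a l\<bar>) = (\<Sum>j<n. \<bar>edge_mat a $$ (i, j)\<bar>)"
proof -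
  have "(\<Sum>l | l < m \<and> r l = i. \<bar>a l\<bar>) = (\<Sum>j<n. \<Sum>l\<in>{l\<in>{l. l < m \<and> r l = i}. c l = j}. \<bar>a l\<bar>)"
    by (rule sum.group[symmetric]) (auto simp: c_less)
  also have "\<dots> = (\<Sum>j<n. \<bar>edge_mat a $$ (i, j)\<bar>)"
    using assms by (intro sum.cong refl) (simp add: abs_entry conj_assoc)
  finally show ?thesis .
qed

text \<open>By symmetry the row sums, the only ones the program computes, also control the backward
  steps of walks.\<close>

lemma col_sum:
  assumes "j < n"
  shows "(\<Sum>l | l < m \<and> c l = j. \<bar>a l\<bar>) = (\<Sum>l | l < m \<and> r l = j. \<bar>a l\<bar>)"
proof -
  have sym: "edge_mat a $$ (i, j) = edge_mat a $$ (j, i)" if "i < n" for i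
  proof -
    have "edge_mat a $$ (i, j) = transpose_mat (edge_mat a) $$ (i, j)"
      using sdd by (simp add: SDD_def)
    then show ?thesis using that assms edge_mat_carrier[of a] by simp
  qed
  have "(\<Sum>l | l < m \<and> c l = j. \<bar>a l\<bar>) = (\<Sum>i<n. \<Sum>l\<in>{l\<in>{l. l < m \<and> c l = j}. r l = i}. \<bar>a l\<bar>)"
    by (rule sum.group[symmetric]) (auto simp: r_less)
  also have "\<dots> = (\<Sum>i<n. \<bar>edge_mat a $$ (i, j)\<bar>)"
    using assms by (intro sum.cong refl) (simp add: abs_entry conj_ac)
  also have "\<dots> = (\<Sum>i<n. \<bar>edge_mat a $$ (j, i)\<bar>)" by (simp add: sym)
  also have "\<dots> = (\<Sum>l | l < m \<and> r l = j. \<bar>a l\<bar>)" by (rule row_sum[OF assms, symmetric])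
  finally show ?thesis .
qed

lemma inf_norm_nonneg: "0 \<le> inf_norm (edge_mat a)"
proof -
  have "0 \<le> (\<Sum>j<n. \<bar>edge_mat a $$ (0, j)\<bar>)" by (intro sum_nonneg) auto
  also have "\<dots> \<le> inf_norm (edge_mat a)" using n1 by (intro inf_norm_ge edge_mat_carrier) auto
  finally show ?thesis .
qed

lemma row_sum_le: "(\<Sum>l<m. if r l = i then \<bar>a l\<bar> else 0) \<le> inf_norm (edge_mat a)"
proof (cases "i < n")
  case True
  have "(\<Sum>l<m. if r l = i then \<bar>a l\<bar> else 0) = (\<Sum>l\<in>{l\<in>{..<m}. r l = i}. \<bar>a l\<bar>)"
    by (rule sum.inter_filter[symmetric]) simp
  also have "\<dots> = (\<Sum>j<n. \<bar>edge_mat a $$ (i, j)\<bar>)" using row_sum[OF True] by simp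
  also have "\<dots> \<le> inf_norm (edge_mat a)" by (intro inf_norm_ge edge_mat_carrier True)
  finally show ?thesis .
next
  case False
  then have "(\<Sum>l<m. if r l = i then \<bar>a l\<bar> else 0) = 0" by (intro sum.neutral) (auto simp: r_less)
  then show ?thesis using inf_norm_nonneg by simp
qed

text \<open>Read off from \<open>0 \<le> inf_norm A \<le> sqrt \<theta> * N\<close>, which spares a
  boundedness argument for the supremum in \<open>op_norm\<close>.\<close>

lemma N_nonneg: "N \<ge> 0"
proof -
  have "0 \<le> sqrt \<theta> * N" using inf_norm_nonneg sdd by (simp add: SDD_def N)
  then show ?thesis using \<theta> by (simp add: zero_le_mult_iff)
qed

lemma inf_norm_le: "inf_norm (edge_mat a) \<le> sqrt \<theta> * N"
  using sdd by (simp add: SDD_def N)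

lemma m_le: "m \<le> n * n"
proof -
  have "card {..<m} \<le> card ({..<n} \<times> {..<n})"
    using inj r_less c_less by (intro card_inj_on_le[of "\<lambda>l. (r l, c l)"]) auto
  then show ?thesis by (simp add: card_cartesian_product)
qed

lemma ln_n: "n \<ge> 2 \<Longrightarrow> ln (real n) \<ge> 2 / 3"
  using ln2_ge_two_thirds ln_le_cancel_iff[of 2 "real n"] by linarith

text \<open>Distinct positions give \<open>m \<le> n * n\<close>, so the harmonic number is at most
  \<open>1 + 2 ln n\<close>, and \<open>ln n \<ge> 2/3\<close> absorbs the 1.\<close>

lemma harm_m_le: 
  assumes "n < m" "n \<ge> 2"
  shows "harm m \<le> 4 * ln (real n)"
proof -
  have "harm m \<le> 1 + ln (real m)" using assms by (intro harm_le_ln) auto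
  also have "ln (real m) \<le> ln (real (n * n))"
    using assms m_le by (subst ln_le_cancel_iff) (simp_all flip: of_nat_mult)
  also have "\<dots> = 2 * ln (real n)" using assms by (simp add: ln_mult)
  finally show ?thesis using ln_n[OF assms(2)] by linarith
qed

lemma wf_kept: "wf_entries n (kept M \<sigma> m)"
proof -
  have "inj_on (\<lambda>l. (r l, c l)) (set (filter \<sigma> [0..<m]))"
    by (rule inj_on_subset[OF inj]) auto
  then show ?thesis
    by (auto simp: wf_entries_def kept_def o_def distinct_map r_less c_less)
qed

lemma wf_result: "wf_entries n (result M \<sigma>)"
  using wf_kept by (simp add: result_def wf_entries_def)

text \<open>Puts the error of the uncut output into the form treated by
  \<open>sampling_error\<close>.\<close>

lemma error_kept:
  "edge_mat a - mat_of_entries n (kept M \<sigma> m) = edge_mat (\<lambda>l. noise (prob (rate M) l) (a l) (\<sigma> l))"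
proof (rule eq_matI)
  fix i j assume ij: "i < dim_row (edge_mat (\<lambda>l. noise (prob (rate M) l) (a l) (\<sigma> l)))"
    "j < dim_col (edge_mat (\<lambda>l. noise (prob (rate M) l) (a l) (\<sigma> l)))"
  then have "i < n" "j < n" by (simp_all add: edge_mat_def)
  moreover from this have "mat_of_entries n (kept M \<sigma> m) $$ (i, j) =
      (\<Sum>l | l < m \<and> r l = i \<and> c l = j. of_bool (\<sigma> l) * (a l / min 1 (prob (rate M) l)))"
    unfolding kept_def by (rule mat_of_entries_map)
  ultimately show "(edge_mat a - mat_of_entries n (kept M \<sigma> m)) $$ (i, j) =
      edge_mat (\<lambda>l. noise (prob (rate M) l) (a l) (\<sigma> l)) $$ (i, j)"
    by (simp add: mat_of_entries_def[of n] edge_mat_def noise_def sum_subtractf)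
qed (simp_all add: edge_mat_def mat_of_entries_def)

lemma rate_identity: "rate M * (e * N)\<^sup>2 = 400 * (M + N) * harm m" if "N \<noteq> 0"
  using that e by (simp add: rate_def power2_eq_square)

section \<open>Size and accuracy of the output for the computed row bound \<open>M\<close>\<close>

context
  fixes M :: real
  assumes M_le: "M \<le> inf_norm (edge_mat a)"
    and M_ge: "\<And>i. (\<Sum>l<m. if r l = i then \<bar>a l\<bar> else 0) \<le> M"
begin

lemma M_nonneg: "0 \<le> M"
  by (rule order_trans[OF sum_nonneg M_ge[of 0]]) auto

lemma row_sum_le_M: "(\<Sum>l | l < m \<and> r l = i. \<bar>a l\<bar>) \<le> M"
proof -
  have "(\<Sum>l\<in>{l\<in>{..<m}. r l = i}. \<bar>a l\<bar>) = (\<Sum>l<m. if r l = i then \<bar>a l\<bar> else 0)"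
    by (rule sum.inter_filter) simp
  then show ?thesis using M_ge[of i] by simp
qed

lemma rate_nonneg: "0 \<le> rate M"
  using M_nonneg N_nonneg e by (simp add: rate_def harm_nonneg)

text \<open>Holds for every outcome, thanks to the cut-off: the output is empty, or has at most
  \<open>n\<close> entries, or respects the threshold, where
  \<open>M + N \<le> 2 sqrt \<theta> N\<close>.\<close>

lemma nnz_result_le:
  "real (nnz (mat_of_entries n (result M \<sigma>))) \<le> 19200 * (real n * \<theta> * ln (real n) / e\<^sup>2)"
proof -
  have nnz: "real (nnz (mat_of_entries n (result M \<sigma>))) \<le> real (length (result M \<sigma>))"
    using nnz_mat_of_entries_le by simp
  have rhs: "0 \<le> 19200 * (real n * \<theta> * ln (real n) / e\<^sup>2)"
    using n1 \<theta> by simp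
  consider "result M \<sigma> = []" | "n \<ge> 2" "m \<le> n" "result M \<sigma> = kept M \<sigma> m"
    | "n \<ge> 2" "n < m" "real (length (result M \<sigma>)) \<le> 3 * rate M * (real n * (M + N))"
    by (cases "n < 2"; cases "n < m";
        cases "3 * rate M * (real n * (M + N)) < real (length (kept M \<sigma> m))") (auto simp: result_def)
  then show ?thesis
  proof cases
    case 1
    then show ?thesis using nnz rhs by simp
  next
    case 2
    have "length (result M \<sigma>) \<le> m"
      using 2 length_filter_le[of \<sigma> "[0..<m]"] by (simp add: kept_def)
    then have "real (length (result M \<sigma>)) \<le> real n" using 2 by simp
    also have "\<dots> \<le> 19200 * (real n * ln (real n))"
      using ln_n[OF 2(1)] mult_left_mono[of 1 "19200 * ln (real n)" "real n"] by simp
    also have "\<dots> \<le> 19200 * (real n * ln (real n)) * (\<theta> / e\<^sup>2)"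
    proof -
      have "e\<^sup>2 \<le> 1" using e by (simp add: power_le_one)
      then have "1 \<le> \<theta> / e\<^sup>2" using \<theta> e by (simp add: le_divide_eq)
      then show ?thesis using n1 mult_left_mono[of 1 "\<theta> / e\<^sup>2" "19200 * (real n * ln (real n))"] by simp
    qed
    finally show ?thesis using nnz by (simp add: mult_ac)
  next
    case 3
    have "3 * rate M * (real n * (M + N)) \<le> 19200 * (real n * \<theta> * ln (real n) / e\<^sup>2)"
    proof (cases "N = 0")
      case True
      then have "rate M = 0" unfolding rate_def by simp
      then show ?thesis using rhs by simp
    next
      case False
      have "M + N \<le> 2 * sqrt \<theta> * N"
      proof -
        have "M \<le> sqrt \<theta> * N" using M_le inf_norm_le by linarith
        moreover have "N \<le> sqrt \<theta> * N" using \<theta> N_nonneg mult_right_mono[of 1 "sqrt \<theta>" N] by simp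
        ultimately show ?thesis by simp
      qed
      then have "(M + N)\<^sup>2 \<le> (2 * sqrt \<theta> * N)\<^sup>2"
        using M_nonneg N_nonneg by (intro power_mono) auto
      also have "\<dots> = 4 * \<theta> * N\<^sup>2" using \<theta> by (simp add: power_mult_distrib)
      finally have J: "(M + N)\<^sup>2 / N\<^sup>2 \<le> 4 * \<theta>" using False by (simp add: divide_le_eq)
      have "3 * rate M * (real n * (M + N)) = 1200 * real n / e\<^sup>2 * (harm m * ((M + N)\<^sup>2 / N\<^sup>2))"
        by (simp add: rate_def power2_eq_square)
      \<comment> \<open>Origin of the final constant: \<open>1200 * 4 * 4 = 19200\<close>.\<close>
      also have "\<dots> \<le> 1200 * real n / e\<^sup>2 * (4 * ln (real n) * (4 * \<theta>))"
        using J harm_m_le[OF 3(2,1)] n1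
        by (intro mult_left_mono mult_mono) (auto simp: harm_nonneg)
      finally show ?thesis by (simp add: mult_ac)
    qed
    then show ?thesis using nnz 3(3) by linarith
  qed
qed

lemma error_small_if_exact:
  assumes "n \<ge> 2" and zero: "\<And>l. l < m \<Longrightarrow> noise (prob (rate M) l) (a l) (\<sigma> l) = 0"
    and "result M \<sigma> = kept M \<sigma> m"
  shows "op_norm (edge_mat a - mat_of_entries n (result M \<sigma>)) \<le> e * N"
proof -
  have "op_norm (edge_mat a - mat_of_entries n (result M \<sigma>)) \<le> 0"
    unfolding assms(3) error_kept
    by (rule op_norm_zero_le[OF edge_mat_carrier]) (auto simp: edge_mat_def zero)
  also have "0 \<le> e * N" using e N_nonneg by simp
  finally show ?thesis .
qed

abbreviation "coins \<equiv> Pi_pmf {..<m} False (\<lambda>l. bernoulli_pmf (prob (rate M) l))"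

text \<open>After the degenerate cases, failure requires a large sampling error or a cut-off; each
  has probability at most \<open>1 / (2 n)\<close>.\<close>

lemma small_error_probability:
  "measure_pmf.prob coins {\<sigma>. op_norm (edge_mat a - mat_of_entries n (result M \<sigma>)) \<le> e * N}
    \<ge> 1 - 1 / real n"
proof -
  let ?good = "\<lambda>\<sigma>. op_norm (edge_mat a - mat_of_entries n (result M \<sigma>)) \<le> e * N"
  have sure: ?thesis if "\<And>\<sigma>. \<sigma> \<in> set_pmf coins \<Longrightarrow> ?good \<sigma>"
  proof -
    have "measure_pmf.prob coins {\<sigma>. ?good \<sigma>} = 1"
      using that by (intro measure_pmf.prob_eq_1[THEN iffD2]) (auto intro: AE_pmfI)
    then show ?thesis by simp
  qed
  consider "n < 2" | "n \<ge> 2" "N = 0" | "n \<ge> 2" "N > 0" "m \<le> n" | "n \<ge> 2" "N > 0" "n < m"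
    using N_nonneg by linarith
  then show ?thesis
  proof cases
    case 1
    \<comment> \<open>The claimed probability is then 0.\<close>
    then have "n = 1" using n1 by simp
    then show ?thesis by simp
  next
    case 2
    \<comment> \<open>Diagonal dominance turns \<open>N = 0\<close> into vanishing row sums, so all
      entries are zero and every outcome is exact.\<close>
    have "inf_norm (edge_mat a) \<le> 0" using inf_norm_le 2 by simp
    then have M0: "M \<le> 0" using M_le by simp
    have a0: "a l = 0" if "l < m" for l
    proof -
      have "\<bar>a l\<bar> \<le> (\<Sum>k | k < m \<and> r k = r l. \<bar>a k\<bar>)"
        using that by (intro member_le_sum) auto
      then show ?thesis using row_sum_le_M[of "r l"] M0 by simp
    qed
    have "op_norm (edge_mat a - mat_of_entries n (result M \<sigma>)) \<le> 0" for \<sigma>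
    proof (rule op_norm_zero_le)
      show "edge_mat a - mat_of_entries n (result M \<sigma>) \<in> carrier_mat n n"
        by (intro carrier_matI) (simp_all add: mat_of_entries_def)
      fix i j assume ij: "i < n" "j < n"
      have "mat_of_entries n (kept M \<sigma> m) $$ (i, j) = 0"
        using ij by (simp add: kept_def mat_of_entries_map a0)
      moreover have "mat_of_entries n [] $$ (i, j) = 0" using ij by (simp add: mat_of_entries_def)
      moreover have "edge_mat a $$ (i, j) = 0" using ij by (simp add: edge_mat_def a0)
      ultimately have "edge_mat a $$ (i, j) - mat_of_entries n (result M \<sigma>) $$ (i, j) = 0"
        by (simp add: result_def)
      then show "(edge_mat a - mat_of_entries n (result M \<sigma>)) $$ (i, j) = 0"
        using ij by (simp add: mat_of_entries_def[of n])
    qed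
    then show ?thesis using 2 by (intro sure) simp
  next
    case 3
    show ?thesis
    proof (rule sure)
      fix \<sigma> assume \<sigma>: "\<sigma> \<in> set_pmf coins"
      show "?good \<sigma>"
      proof (rule error_small_if_exact[OF 3(1)])
        fix l assume l: "l < m"
        \<comment> \<open>As \<open>m \<le> n\<close>, the truncated difference adds 1.\<close>
        have p: "prob (rate M) l \<ge> 1" using 3 rate_nonneg by (simp add: prob_def)
        have "\<sigma> l \<in> set_pmf (bernoulli_pmf (prob (rate M) l))"
          using \<sigma> l by (auto simp: set_Pi_pmf PiE_dflt_def)
        then show "noise (prob (rate M) l) (a l) (\<sigma> l) = 0"
          using p by (simp add: bernoulli_pmf_ge_1 noise_def)
      qed (use 3 in \<open>simp add: result_def\<close>)
    qed
  next
    case 4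
    let ?K = "rate M" and ?J = "M + N"
    define \<mu> where "\<mu> = ?K * (real n * ?J)"
    have J: "?J > 0" using M_nonneg 4 by simp
    have h: "ln (real n) \<le> harm m"
    proof -
      have "ln (real n) \<le> ln (real m + 1)" using 4 by (subst ln_le_cancel_iff) auto
      then show ?thesis using ln_le_harm[of m] by linarith
    qed
    have harm: "harm m > (0::real)" using h ln_n[OF 4(1)] by linarith
    have K: "?K > 0" using J e 4 harm by (simp add: rate_def)
    have \<delta>: "0 < e * N" "e * N \<le> ?J"
    proof -
      show "0 < e * N" using e 4 by simp
      have "e * N \<le> 1 * N" using e 4 by (intro mult_right_mono) auto
      then show "e * N \<le> ?J" using M_nonneg by simp
    qed
    have rate: "?K * (e * N)\<^sup>2 = 400 * ?J * harm m" by (rule rate_identity) (use 4 in simp)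
    have p: "prob ?K l = ?K * \<bar>a l\<bar>" for l using 4 by (simp add: prob_def)
    have "measure_pmf.prob coins {\<sigma>. e * N < op_norm (edge_mat (\<lambda>l. noise (prob ?K l) (a l) (\<sigma> l)))}
        \<le> 1 / (2 * real n)"
    proof (rule sampling_error[OF 4(1) K J \<delta> h])
      show "400 * ?J * harm m \<le> ?K * (e * N)\<^sup>2" using rate by simp
      show "(\<Sum>l | l < m \<and> r l = i. \<bar>a l\<bar>) \<le> ?J" for i
        using row_sum_le_M[of i] 4 by simp
      show "(\<Sum>l | l < m \<and> c l = j. \<bar>a l\<bar>) \<le> ?J" if "j < n" for j
        using row_sum_le_M[of j] col_sum[OF that] 4 by simp
    qed (rule p)
    moreover have "measure_pmf.prob coins {\<sigma>. 3 * \<mu> < real (length (filter \<sigma> [0..<m]))}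
        \<le> 1 / (2 * real n)"
    proof -
      \<comment> \<open>Summing by rows bounds the expected number of kept entries by
        \<open>\<mu>\<close>.\<close>
      have "(\<Sum>l<m. \<bar>a l\<bar>) = (\<Sum>i<n. \<Sum>l\<in>{l\<in>{..<m}. r l = i}. \<bar>a l\<bar>)"
        by (rule sum.group[symmetric]) (auto simp: r_less)
      also have "\<dots> \<le> (\<Sum>i<n. ?J)"
        using row_sum_le_M 4 by (intro sum_mono) (simp add: add_increasing2)
      finally have "(\<Sum>l<m. prob ?K l) \<le> \<mu>"
        using K unfolding p \<mu>_def by (simp flip: sum_distrib_left)
      then have "measure_pmf.prob coins {\<sigma>. 3 * \<mu> < real (length (filter \<sigma> [0..<m]))} \<le> exp (- \<mu>)"
        using rate_nonneg by (intro count_tail) (auto simp: p)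
      \<comment> \<open>The rate and \<open>e * N \<le> M + N\<close> give
        \<open>\<mu> \<ge> 400 * harm m\<close>, far above \<open>2 ln n\<close>.\<close>
      also have "\<dots> \<le> exp (- (2 * ln (real n)))"
      proof -
        have "?J * (400 * harm m) \<le> ?J * (?K * ?J)"
        proof -
          have "(e * N)\<^sup>2 \<le> ?J\<^sup>2" using \<delta> by (intro power_mono) auto
          then have "?K * (e * N)\<^sup>2 \<le> ?K * ?J\<^sup>2" using K by (intro mult_left_mono) auto
          then show ?thesis unfolding rate by (simp add: power2_eq_square mult_ac)
        qed
        then have "400 * harm m \<le> ?K * ?J" using J by simp
        also have "\<dots> \<le> \<mu>"
          using K J n1 mult_left_mono[of 1 "real n" "?K * ?J"] by (simp add: \<mu>_def mult_ac)
        finally have "2 * ln (real n) \<le> \<mu>" using h ln_n[OF 4(1)] by linarith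
        then show ?thesis by simp
      qed
      also have "\<dots> = 1 / (real n * real n)"
      proof -
        have "exp (2 * ln (real n)) = real n * real n"
          using n1 unfolding mult_2 exp_add by simp
        then show ?thesis unfolding exp_minus by (simp add: inverse_eq_divide)
      qed
      also have "\<dots> \<le> 1 / (2 * real n)"
        using 4 by (intro divide_left_mono mult_right_mono) auto
      finally show ?thesis .
    qed
    ultimately have bad: "measure_pmf.prob coins
        ({\<sigma>. e * N < op_norm (edge_mat (\<lambda>l. noise (prob ?K l) (a l) (\<sigma> l)))} \<union>
         {\<sigma>. 3 * \<mu> < real (length (filter \<sigma> [0..<m]))}) \<le> 1 / (2 * real n) + 1 / (2 * real n)"
      by (intro order_trans[OF measure_Un_le] add_mono) simp_all
    \<comment> \<open>If the output is not cut, its error is exactly the noise matrix.\<close>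
    have "measure_pmf.prob coins (- {\<sigma>. ?good \<sigma>}) \<le> measure_pmf.prob coins
        ({\<sigma>. e * N < op_norm (edge_mat (\<lambda>l. noise (prob ?K l) (a l) (\<sigma> l)))} \<union>
         {\<sigma>. 3 * \<mu> < real (length (filter \<sigma> [0..<m]))})"
    proof (intro measure_pmf.finite_measure_mono subsetI)
      fix \<sigma> assume "\<sigma> \<in> - {\<sigma>. ?good \<sigma>}"
      then have bad: "\<not> ?good \<sigma>" by simp
      show "\<sigma> \<in> {\<sigma>. e * N < op_norm (edge_mat (\<lambda>l. noise (prob ?K l) (a l) (\<sigma> l)))} \<union>
         {\<sigma>. 3 * \<mu> < real (length (filter \<sigma> [0..<m]))}"
      proof (cases "3 * \<mu> < real (length (filter \<sigma> [0..<m]))")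
        case False
        then have "result M \<sigma> = kept M \<sigma> m"
          using 4 by (simp add: result_def kept_def \<mu>_def mult.assoc)
        then show ?thesis using bad by (simp add: error_kept not_le)
      qed simp
    qed simp
    also note bad
    also have "1 / (2 * real n) + 1 / (2 * real n) = 1 / real n" using n1 by (simp add: field_simps)
    finally show ?thesis
      using measure_pmf.prob_compl[of "{\<sigma>. ?good \<sigma>}" coins] by (simp add: Compl_eq_Diff_UNIV)
  qed
qed

end

end

text \<open>Only translation remains: listed entries become edges. Time and size are bounded for
  every outcome; chance affects only the error.\<close>

theorem theorem9:
  shows "\<exists>(alg::com) (C::real) (c::nat).
    \<forall>(n::nat) (\<theta>::real) (A::real mat) (\<epsilon>::real) (es::entries).
      n \<ge> 1 \<longrightarrow> \<theta> \<ge> 1 \<longrightarrow> A \<in> carrier_mat n n \<longrightarrow> SDD \<theta> A \<longrightarrow> 0 < \<epsilon> \<longrightarrow> \<epsilon> < 1 \<longrightarrow>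
      wf_entries n es \<longrightarrow> mat_of_entries n es = A \<longrightarrow>
      (\<exists>D. run alg (input_state n es (op_norm A) \<epsilon>) D \<and>
        (\<forall>(s, t) \<in> set_pmf D.
           t \<le> c * input_size es \<and>
           wf_entries n (output_entries s) \<and>
           real (nnz (output_mat n s)) \<le> C * (real n * \<theta> * ln (real n) / \<epsilon>\<^sup>2)) \<and>
        measure_pmf.prob D {(s, t). op_norm (A - output_mat n s) \<le> \<epsilon> * op_norm A}
          \<ge> 1 - 1 / real n)"
proof (rule exI[of _ sparsify], rule exI[of _ "19200::real"], rule exI[of _ "7::nat"], intro allI impI)
  fix n :: nat and \<theta> :: real and A :: "real mat" and \<epsilon> :: real and es :: entries
  assume n: "n \<ge> 1" and \<theta>: "\<theta> \<ge> 1" and A: "A \<in> carrier_mat n n" "SDD \<theta> A"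
    and \<epsilon>: "0 < \<epsilon>" "\<epsilon> < 1" and es: "wf_entries n es" "mat_of_entries n es = A"
  define m where "m = length es"
  define r where "r l = (if l < length es then fst (es ! l) else 0)" for l
  define c where "c l = (if l < length es then fst (snd (es ! l)) else 0)" for l
  define a where "a l = (if l < length es then snd (snd (es ! l)) else 0)" for l
  let ?s = "input_state n es (op_norm A) \<epsilon>"
  have less: "r l < n" "c l < n" if "l < m" for l
  proof -
    have "es ! l \<in> set es" using that by (simp add: m_def)
    then have "case es ! l of (i, j, x) \<Rightarrow> i < n \<and> j < n" using es(1) by (auto simp: wf_entries_def)
    then show "r l < n" "c l < n" using that by (auto simp: r_def c_def m_def split: prod.splits)
  qed
  interpret edges n m r c by unfold_locales (simp_all add: less)
  \<comment> \<open>The trivial filter lets \<open>mat_of_entries_map\<close> apply to the input as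
    well.\<close>
  have es_map: "es = map (\<lambda>l. (r l, c l, a l)) (filter (\<lambda>_. True) [0..<m])"
    by (rule nth_equalityI) (simp_all add: r_def c_def a_def m_def)
  have A_eq: "edge_mat a = A"
  proof (rule eq_matI)
    fix i j assume "i < dim_row A" "j < dim_col A"
    then have ij: "i < n" "j < n" using A by auto
    have "A $$ (i, j) = (\<Sum>l | l < m \<and> r l = i \<and> c l = j. of_bool True * a l)"
      unfolding es(2)[symmetric] by (subst es_map, rule mat_of_entries_map[OF ij])
    then show "edge_mat a $$ (i, j) = A $$ (i, j)" using ij by (simp add: edge_mat_def)
  qed (use A in \<open>auto simp: edge_mat_def\<close>)
  have inj: "inj_on (\<lambda>l. (r l, c l)) {..<m}"
  proof -
    have "distinct (map (\<lambda>l. (r l, c l)) [0..<m])"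
      using es(1) unfolding wf_entries_def by (subst (asm) es_map) (simp add: o_def)
    then show ?thesis by (simp add: distinct_map lessThan_atLeast0)
  qed
  interpret sparsification n m r c a "op_norm A" \<epsilon> \<theta>
    by unfold_locales (use inj n A \<theta> \<epsilon> A_eq in auto)
  have init: "input ?s" "rmem ?s ''rowsum'' i = 0" "rmem ?s ''max'' 0 = 0" "rmem ?s ''harm'' 0 = 0"
    "nmem ?s ''i'' 0 = 0" for i
    unfolding input_def by (simp_all add: input_state_def m_def r_def c_def a_def)
  obtain M g where M: "M \<le> inf_norm (edge_mat a)" "\<And>i. (\<Sum>l<m. if r l = i then \<bar>a l\<bar> else 0) \<le> M"
    and g: "\<And>\<sigma>. output_entries (g \<sigma>) = result M \<sigma>"
    and runs: "runs sparsify ?s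
      (map_pmf g (Pi_pmf {..<m} False (\<lambda>l. bernoulli_pmf (prob (rate M) l)))) (m * 21 + 8)"
    by (rule runs_sparsify[OF init row_sum_le]) (rule that)
  let ?P = "Pi_pmf {..<m} False (\<lambda>l. bernoulli_pmf (prob (rate M) l))"
  from runs obtain D where D: "run sparsify ?s D" "map_pmf fst D = map_pmf g ?P"
    "\<forall>x\<in>set_pmf D. snd x \<le> m * 21 + 8"
    unfolding runs_def by blast
  have out: "output_mat n (g \<sigma>) = mat_of_entries n (result M \<sigma>)" for \<sigma>
    by (simp add: output_mat_def g)
  have "\<forall>(s, t) \<in> set_pmf D.
      t \<le> 7 * input_size es \<and>
      wf_entries n (output_entries s) \<and>
      real (nnz (output_mat n s)) \<le> 19200 * (real n * \<theta> * ln (real n) / \<epsilon>\<^sup>2)"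
  proof (rule ballI, rule case_prodI2)
    fix x s t
    assume x: "x \<in> set_pmf D" "x = (s, t)"
    have "s \<in> set_pmf (map_pmf fst D)" using x by force
    then obtain \<sigma> where \<sigma>: "s = g \<sigma>" unfolding D(2) by auto
    have "t \<le> m * 21 + 8" using D(3) x by force
    \<comment> \<open>The input size is \<open>3 m + 4\<close>, and
      \<open>21 m + 8 \<le> 7 * (3 m + 4)\<close>.\<close>
    then have "t \<le> 7 * input_size es" by (simp add: input_size_def m_def)
    moreover have "wf_entries n (output_entries s)" unfolding \<sigma> g by (rule wf_result)
    moreover have "real (nnz (output_mat n s)) \<le> 19200 * (real n * \<theta> * ln (real n) / \<epsilon>\<^sup>2)"
      unfolding \<sigma> out by (rule nnz_result_le[OF M])
    ultimately show "t \<le> 7 * input_size es \<and> wf_entries n (output_entries s) \<and>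
        real (nnz (output_mat n s)) \<le> 19200 * (real n * \<theta> * ln (real n) / \<epsilon>\<^sup>2)" by blast
  qed
  moreover have "measure_pmf.prob D {(s, t). op_norm (A - output_mat n s) \<le> \<epsilon> * op_norm A}
      \<ge> 1 - 1 / real n"
  proof -
    \<comment> \<open>The error does not depend on the running time, so the marginal law of the
      state suffices.\<close>
    have "measure_pmf.prob D {(s, t). op_norm (A - output_mat n s) \<le> \<epsilon> * op_norm A}
        = measure_pmf.prob (map_pmf fst D) {s. op_norm (A - output_mat n s) \<le> \<epsilon> * op_norm A}"
      by (simp add: vimage_def case_prod_unfold)
    also have "\<dots> = measure_pmf.prob ?P {\<sigma>. op_norm (A - mat_of_entries n (result M \<sigma>)) \<le> \<epsilon> * op_norm A}"
      unfolding D(2) by (simp add: vimage_def out)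
    finally show ?thesis using small_error_probability[OF M] by (simp add: A_eq)
  qed
  ultimately show "\<exists>D. run sparsify ?s D \<and>
        (\<forall>(s, t) \<in> set_pmf D.
           t \<le> 7 * input_size es \<and>
           wf_entries n (output_entries s) \<and>
           real (nnz (output_mat n s)) \<le> 19200 * (real n * \<theta> * ln (real n) / \<epsilon>\<^sup>2)) \<and>
        measure_pmf.prob D {(s, t). op_norm (A - output_mat n s) \<le> \<epsilon> * op_norm A}
          \<ge> 1 - 1 / real n"
    using D(1) by blast
qed

end
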